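(* The complete graph $K_n$ is mature for every $n\ge 5$.
   Context: A graph means a finite 1-dimensional simplicial complex. For a space $X$, $F(X,2)=\{(x,y)\in X\times X: x\neq y\}$. Homology is with integer coefficients. A finite connected graph $\Gamma$ which is not homeomorphic to the interval $[0,1]$ is called mature if the homomorphism $\alpha_*:H_1(F(\Gamma,2))\to H_1(\Gamma\times\Gamma)$ induced by the inclusion $\alpha:F(\Gamma,2)\to\Gamma\times\Gamma$ is an isomorphism. *)

theory Defs
  imports "HOL-Homology.Homology"
begin

definition simplicial_complex_on :: "'v set set \<Rightarrow> bool" where
  "simplicial_complex_on K \<longleftrightarrow>
     (\<forall>s\<in>K. finite s \<and> s \<noteq> {}) \<and> (\<forall>s\<in>K. \<forall>t. t \<subseteq> s \<and> t \<noteq> {} \<longrightarrow> t \<in> K)"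

definition finite_graph :: "'v set set \<Rightarrow> bool" where
  "finite_graph K \<longleftrightarrow> finite K \<and> simplicial_complex_on K \<and>
     (\<forall>s\<in>K. card s \<le> 2) \<and> (\<exists>s\<in>K. card s = 2)"

text \<open>
  The geometric realization in barycentric coordinates: a point is a function on the vertices,
  and its support is the unique open simplex containing it. For a finite complex the topology
  of pointwise convergence is the usual topology of the polyhedron. The vertices of \<open>K\<close> are the
  elements of \<open>\<Union>K\<close>; coordinates outside \<open>\<Union>K\<close> vanish.
\<close>
definition realization :: "'v set set \<Rightarrow> ('v \<Rightarrow> real) topology" where
  "realization K = subtopology (powertop_real UNIV)
     {x. (\<forall>v. 0 \<le> x v) \<and> {v. x v \<noteq> 0} \<in> K \<and> (\<Sum>v | x v \<noteq> 0. x v) = 1}"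

definition config_space2 :: "'a topology \<Rightarrow> ('a \<times> 'a) topology" where
  "config_space2 X = subtopology (prod_topology X X) {(x, y). x \<noteq> y}"

definition mature :: "'v set set \<Rightarrow> bool" where
  "mature K \<longleftrightarrow> finite_graph K \<and> connected_space (realization K) \<and>
     \<not> realization K homeomorphic_space top_of_set {0..1::real} \<and>
     hom_induced 1 (config_space2 (realization K)) {}
                   (prod_topology (realization K) (realization K)) {} id
       \<in> iso (homology_group 1 (config_space2 (realization K)))
             (homology_group 1 (prod_topology (realization K) (realization K)))"

definition complete_graph :: "nat \<Rightarrow> nat set set" where
  "complete_graph n = {s. s \<subseteq> {..<n} \<and> s \<noteq> {} \<and> card s \<le> 2}"

end

theory Submission
  imports Defs
begin

text \<open>
  Write \<open>\<Gamma>\<close> for the polyhedron of the complete graph, \<open>X = \<Gamma> \<times> \<Gamma>\<close>, and \<open>F\<close> for the complement of the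
  diagonal. Both are treated at once as a space \<open>S\<close> of pairs with a covering by open sets \<open>U u v\<close>,
  each star-shaped about the pair of vertices \<open>(u, v)\<close>. For \<open>X\<close> these are products of open vertex
  stars. For \<open>F\<close> one takes the pairs \<open>(x, y)\<close> with \<open>x\<^sub>u > y\<^sub>u\<close> and \<open>y\<^sub>v > x\<^sub>v\<close>: two distinct points of a
  simplex always have such \<open>u\<close> and \<open>v\<close>, moving \<open>x\<close> towards \<open>u\<close> and \<open>y\<close> towards \<open>v\<close> preserves the
  inequalities, and two of these sets meet only if the edges (or vertices) \<open>{u, u'}\<close> and \<open>{v, v'}\<close>
  are disjoint. So \<open>F\<close> behaves like the complex of products of disjoint simplices.

  In such a space, a 1-cycle whose simplices are small is homologous to a combination of edges
  joining pairs of vertices: connect the ends of each small simplex to the centres of the covering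
  sets that contain them. An edge moves one coordinate from a vertex \<open>a\<close> to a vertex \<open>b\<close> and keeps the
  other one at \<open>w\<close>. Closing it up through the vertex \<open>0\<close> gives a triangle loop \<open>(0ab, w)\<close>. Modulo
  boundaries this loop is independent of the position \<open>w\<close>, because of the squares, and the loops
  around the suitably oriented four faces of a tetrahedron add up to \<open>0\<close>; it is for the latter that
  a fifth vertex is needed, on which the other coordinate can rest. From this one derives that the class of an edge is the
  class of its triangle loop up to the difference of a function \<open>H\<close> at the two ends (proposition
  \<open>edge_class\<close>). Therefore a small cycle \<open>c\<close> is homologous to its \<open>loop_part\<close>, a combination of
  triangle loops (proposition \<open>small_cycle_homologous_loop_part\<close>).

  The loop part has two virtues. It depends only on the passage of the two coordinates of \<open>c\<close>
  through the edges of the graph, and so vanishes identically when \<open>c\<close> is the boundary of a small chain in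
  \<open>X\<close> (\<open>loop_part_boundary\<close>); and it is always a cycle in \<open>F\<close>, even if \<open>c\<close> is only a cycle in \<open>X\<close>
  (\<open>loop_part_cycle\<close>). After barycentric subdivision, the first makes the map
  \<open>H\<^sub>1(F) \<rightarrow> H\<^sub>1(X)\<close> injective and the second makes it surjective.

  Finally \<open>\<Gamma>\<close> is a union of stars through a common vertex, hence connected, and it is not an interval
  because it contains a point at which three arcs meet.
\<close>

section \<open>Cocycles on pairs of vertices\<close>

text \<open>
  The argument \<open>e a v b w\<close> stands for the edge from \<open>(a, v)\<close> to \<open>(b, w)\<close>. The definitions are for the
  first coordinate; they are applied to the second one by exchanging the roles of the arguments of \<open>e\<close>.
\<close>

definition triangle_loop :: "(nat \<Rightarrow> nat \<Rightarrow> nat \<Rightarrow> nat \<Rightarrow> 'g::ab_group_add) \<Rightarrow> nat \<Rightarrow> nat \<Rightarrow> nat \<Rightarrow> nat \<Rightarrow> 'g" where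
  "triangle_loop e a b c w = e a w b w + e b w c w + e c w a w"

text \<open>
  The loop \<open>(0ab, w)\<close> with the least \<open>w\<close> off the triangle. The case distinction makes the function
  antisymmetric on the nose, and not only up to boundaries; this is what makes the loop part of a
  boundary equal to zero.
\<close>

definition base_loop :: "(nat \<Rightarrow> nat \<Rightarrow> nat \<Rightarrow> nat \<Rightarrow> 'g::ab_group_add) \<Rightarrow> nat \<Rightarrow> nat \<Rightarrow> 'g" where
  "base_loop e a b =
    (if a < b then triangle_loop e 0 a b (LEAST w. w \<notin> {0, a, b})
     else if b < a then - triangle_loop e 0 b a (LEAST w. w \<notin> {0, a, b}) else 0)"

lemma base_loop_refl [simp]: "base_loop e a a = 0"
  by (simp add: base_loop_def)

lemma base_loop_swap: "base_loop e b a = - base_loop e a b"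
  by (simp add: base_loop_def insert_commute)

lemma exists_fresh:
  fixes a b c d n :: nat
  assumes "5 \<le> n"
  shows "\<exists>w<n. w \<notin> {a, b, c, d}"
proof -
  have "card {a, b, c, d} \<le> 4"
    using card_length[of "[a, b, c, d]"] by simp
  then have "\<not> {..<n} \<subseteq> {a, b, c, d}"
    using card_mono[of "{a, b, c, d}" "{..<n}"] assms by auto
  then show ?thesis by blast
qed

lemma least_fresh:
  fixes a b n :: nat
  assumes "5 \<le> n" and v: "v = (LEAST w. w \<notin> {0, a, b})"
  shows "v \<notin> {0, a, b}" "v < n"
proof -
  obtain w where w: "w < n" "w \<notin> {0, a, b}"
    using exists_fresh[OF assms(1), of 0 a b b] by auto
  show "v \<notin> {0, a, b}" unfolding v by (rule LeastI[of _ w]) (rule w(2))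
  have "v \<le> w" unfolding v by (rule Least_le) (rule w(2))
  with w(1) show "v < n" by simp
qed

lemma base_loop_closed:
  assumes "5 \<le> n" "a < n" "b < n" "0 \<in> Z" "\<And>z. z \<in> Z \<Longrightarrow> - z \<in> Z"
    and loop: "\<And>a b c w. \<lbrakk>a < n; b < n; c < n; w < n; w \<notin> {a, b, c}\<rbrakk> \<Longrightarrow> triangle_loop e a b c w \<in> Z"
  shows "base_loop e a b \<in> Z"
proof -
  define w where "w = (LEAST w. w \<notin> {0, a, b})"
  note w = least_fresh[OF assms(1) w_def]
  have "triangle_loop e 0 a b w \<in> Z" "triangle_loop e 0 b a w \<in> Z"
    using w assms(1-3) by (auto intro!: loop)
  then show ?thesis
    unfolding base_loop_def w_def[symmetric] using assms(4,5) by simp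
qed

text \<open>
  \<open>B\<close> plays the part of the boundaries, and \<open>allowed u w\<close> says that \<open>(u, w)\<close> is a vertex of the
  complex of pairs: any two vertices for the square of the graph, distinct ones for the configuration
  space. The cells are products of simplices (of at most two vertices each) all of whose vertices are
  allowed, and the last assumption says that \<open>e\<close> is a cocycle modulo \<open>B\<close> on the triangles in a cell.
  The value \<open>5\<close> enters through \<open>exists_fresh\<close>.
\<close>

locale edge_cocycle =
  fixes B :: "'g::ab_group_add set" and n :: nat and allowed :: "nat \<Rightarrow> nat \<Rightarrow> bool"
    and e :: "nat \<Rightarrow> nat \<Rightarrow> nat \<Rightarrow> nat \<Rightarrow> 'g"
  assumes B_zero: "0 \<in> B"
    and B_diff: "\<And>x y. \<lbrakk>x \<in> B; y \<in> B\<rbrakk> \<Longrightarrow> x - y \<in> B"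
    and n5: "5 \<le> n"
    and allowed_neq: "\<And>u w. u \<noteq> w \<Longrightarrow> allowed u w"
    and triangle: "\<And>a a' a'' b b' b''. \<lbrakk>{a, a', a''} \<subseteq> {..<n}; {b, b', b''} \<subseteq> {..<n};
        card {a, a', a''} \<le> 2; card {b, b', b''} \<le> 2;
        \<forall>x\<in>{a, a', a''}. \<forall>y\<in>{b, b', b''}. allowed x y\<rbrakk>
        \<Longrightarrow> e a b a' b' + e a' b' a'' b'' - e a b a'' b'' \<in> B"
begin

lemma B_add: "x \<in> B \<Longrightarrow> y \<in> B \<Longrightarrow> x + y \<in> B"
  using B_diff[of x "0 - y"] B_diff[of 0 y] B_zero by simp

lemma B_eq: "h \<in> B \<Longrightarrow> g = h \<Longrightarrow> g \<in> B"
  by simp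

text \<open>
  The symmetry of the situation, by which facts about the first coordinate give those about the
  second one.
\<close>

lemma swapped: "edge_cocycle B n (\<lambda>u w. allowed w u) (\<lambda>b a b' a'. e a b a' b')"
proof (unfold_locales, goal_cases)
  case 1 show ?case by (rule B_zero)
next
  case (2 x y) then show ?case by (rule B_diff)
next
  case 3 show ?case by (rule n5)
next
  case (4 u w) then show ?case by (simp add: allowed_neq)
next
  case (5 a a' a'' b b' b'')
  from 5(5) have "\<forall>x\<in>{b, b', b''}. \<forall>y\<in>{a, a', a''}. allowed x y" by blast
  then show ?case by (rule triangle[OF 5(2,1,4,3)])
qed

lemma const_edge:
  assumes "a < n" "w < n" "allowed a w"
  shows "e a w a w \<in> B"
  using triangle[of a a a w w w] assms by simp

lemma reverse_edge:
  assumes "a < n" "b < n" "w < n" "allowed a w" "allowed b w"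
  shows "e a w b w + e b w a w \<in> B"
proof -
  have "e a w b w + e b w a w - e a w a w \<in> B"
    using assms by (intro triangle) (auto simp: card_insert_if)
  from B_add[OF this const_edge[of a w]] show ?thesis using assms by simp
qed

lemma square:
  assumes "a < n" "b < n" "w < n" "w' < n" "allowed a w" "allowed b w" "allowed a w'" "allowed b w'"
  shows "e a w b w + e b w b w' - e a w a w' - e a w' b w' \<in> B"
proof -
  have 1: "e a w b w + e b w b w' - e a w b w' \<in> B"
    using assms by (intro triangle) (auto simp: card_insert_if)
  have 2: "e a w a w' + e a w' b w' - e a w b w' \<in> B"
    using assms by (intro triangle) (auto simp: card_insert_if)
  show ?thesis
    by (rule B_eq[OF B_diff[OF 1 2]]) (simp add: algebra_simps)
qed

abbreviation (input) loop where "loop \<equiv> triangle_loop e"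

text \<open>
  The loops at \<open>w\<close> and \<open>w'\<close> bound a prism made of three squares.
\<close>

lemma loop_move:
  assumes "a < n" "b < n" "c < n" "w < n" "w' < n"
    and "allowed a w" "allowed b w" "allowed c w" "allowed a w'" "allowed b w'" "allowed c w'"
  shows "loop a b c w - loop a b c w' \<in> B"
proof -
  note sq = B_add[OF B_add[OF square[of a b w w'] square[of b c w w']] square[of c a w w']]
  show ?thesis
    by (rule B_eq[OF sq]) (use assms in \<open>simp_all add: triangle_loop_def algebra_simps\<close>)
qed

text \<open>
  The edges of a tetrahedron lie on two faces each, with opposite orientations up to
  \<open>reverse_edge\<close>.
\<close>

lemma loop_boundary_tetrahedron:
  assumes "a < n" "b < n" "c < n" "d < n" "w < n" "allowed a w" "allowed b w" "allowed c w" "allowed d w"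
  shows "loop b c d w - loop a c d w + loop a b d w - loop a b c w \<in> B"
  by (rule B_eq[OF B_diff[OF reverse_edge[of b d w] reverse_edge[of a c w]]])
     (use assms in \<open>simp_all add: triangle_loop_def algebra_simps\<close>)

lemma loop_base:
  assumes "a < n" "b < n" "w < n" "allowed 0 w" "allowed a w" "allowed b w"
  shows "loop 0 a b w - base_loop e a b \<in> B"
proof -
  define v where "v = (LEAST w. w \<notin> {0, a, b})"
  note v = least_fresh[OF n5 v_def]
  have okv: "allowed 0 v" "allowed a v" "allowed b v" using v allowed_neq by auto
  have n0: "0 < n" using n5 by simp
  consider "a < b" | "b < a" | "a = b" by linarith
  then show ?thesis
  proof cases
    case 1
    then show ?thesis
      using loop_move[of 0 a b w v] assms okv v n0 by (simp add: base_loop_def v_def)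
  next
    case 2
    have m: "loop 0 b a w - loop 0 b a v \<in> B"
      using loop_move assms okv v n0 by simp
    note r = B_add[OF B_add[OF reverse_edge[of 0 a w] reverse_edge[of a b w]] reverse_edge[of b 0 w]]
    have "loop 0 a b w + loop 0 b a v \<in> B"
      by (rule B_eq[OF B_diff[OF r m]])
         (use assms n0 in \<open>simp_all add: triangle_loop_def algebra_simps\<close>)
    then show ?thesis using 2 by (simp add: base_loop_def v_def)
  next
    case 3
    show ?thesis
      by (rule B_eq[OF B_add[OF reverse_edge[of 0 a w] const_edge[of a w]]])
         (use assms n0 3 in \<open>simp_all add: triangle_loop_def algebra_simps\<close>)
  qed
qed

text \<open>
  Move the loop to a position outside \<open>{0, r, a, b}\<close> and use the tetrahedron on these four vertices.
  Here five vertices are needed.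
\<close>

lemma loop_expand:
  assumes "r < n" "a < n" "b < n" "w < n" "allowed r w" "allowed a w" "allowed b w"
  shows "loop r a b w - (base_loop e a b - base_loop e r b + base_loop e r a) \<in> B"
proof -
  obtain v where v: "v < n" "v \<notin> {0, r, a, b}"
    using exists_fresh[OF n5, of 0 r a b] by auto
  have okv: "allowed 0 v" "allowed r v" "allowed a v" "allowed b v" using v allowed_neq by auto
  have n0: "0 < n" using n5 by simp
  have m: "loop r a b w - loop r a b v \<in> B" using loop_move assms v okv by simp
  have t: "loop r a b v - loop 0 a b v + loop 0 r b v - loop 0 r a v \<in> B"
    using loop_boundary_tetrahedron[of 0 r a b v] n0 assms v okv by simp
  have b: "loop 0 a b v - base_loop e a b \<in> B" "loop 0 r b v - base_loop e r b \<in> B"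
       "loop 0 r a v - base_loop e r a \<in> B"
    using loop_base assms v okv by auto
  show ?thesis
    by (rule B_eq[OF B_add[OF B_add[OF m t] B_add[OF B_diff[OF b(1,2)] b(3)]]])
       (simp add: algebra_simps)
qed

text \<open>
  An edge is horizontal if the first coordinate moves. The one from \<open>a\<close> to \<open>b\<close> at \<open>w\<close> is the loop
  \<open>(rab, w)\<close> minus the two edges at \<open>r\<close>, and \<open>loop_expand\<close> compares this loop with the standard one. Both
  corrections are differences of a function of the end points. The vertex \<open>r\<close> may depend on \<open>w\<close>, and has to if \<open>r = w\<close>
  is to be avoided.
\<close>

lemma horizontal_edge:
  "\<exists>L. \<forall>a<n. \<forall>b<n. \<forall>w<n. allowed a w \<longrightarrow> allowed b w \<longrightarrow>
        e a w b w - (base_loop e a b + L b w - L a w) \<in> B"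
proof -
  define r where "r w = (if w = 0 then 1 else 0 :: nat)" for w :: nat
  have r: "r w < n" "allowed (r w) w" for w
    using n5 allowed_neq by (auto simp: r_def)
  define L where "L b w = e (r w) w b w - base_loop e (r w) b" for b w
  have "e a w b w - (base_loop e a b + L b w - L a w) \<in> B"
    if *: "a < n" "b < n" "w < n" "allowed a w" "allowed b w" for a b w
  proof -
    note l = loop_expand[OF r(1) *(1-3) r(2) *(4,5)]
    note rev = reverse_edge[OF *(2) r(1) *(3) *(5) r(2)]
    show ?thesis
      by (rule B_eq[OF B_diff[OF l rev]]) (simp add: triangle_loop_def L_def algebra_simps)
  qed
  then show ?thesis by blast
qed

text \<open>
  A function of two variables is a sum of functions of one variable if its mixed differences
  vanish. Only those mixed differences are available that avoid the pairs that are not allowed, so that the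
  increment of \<open>M\<close> from \<open>a\<close> to \<open>b\<close> has to be read off at a vertex \<open>u\<close> away from \<open>0\<close>, \<open>a\<close>, and \<open>b\<close>.
\<close>

lemma split_mixed_difference:
  assumes M: "\<And>a b w w'. \<lbrakk>a < n; b < n; w < n; w' < n; allowed a w; allowed b w; allowed a w'; allowed b w'\<rbrakk>
      \<Longrightarrow> M b w - M a w - (M b w' - M a w') \<in> B"
  shows "\<exists>f g. \<forall>a<n. \<forall>w<n. allowed a w \<longrightarrow> M a w - (f a + g w) \<in> B"
proof -
  have n0: "0 < n" using n5 by simp
  have "\<forall>a. \<exists>v. v < n \<and> allowed 0 v \<and> allowed a v"
    using exists_fresh[OF n5, of 0 0] allowed_neq by (metis insertCI)
  then obtain v where v: "\<And>a. v a < n" "\<And>a. allowed 0 (v a)" "\<And>a. allowed a (v a)"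
    by metis
  define f where "f a = M a (v a) - M 0 (v a)" for a
  have f: "M b w - M a w - (f b - f a) \<in> B"
    if *: "a < n" "b < n" "w < n" "allowed a w" "allowed b w" for a b w
  proof -
    obtain u where u: "u < n" "u \<notin> {0, a, b, b}"
      using exists_fresh[OF n5, of 0 a b b] by blast
    then have oku: "allowed 0 u" "allowed a u" "allowed b u" using allowed_neq by auto
    have 1: "M b w - M a w - (M b u - M a u) \<in> B"
      by (rule M) (fact * u(1) oku)+
    have 2: "M b u - M 0 u - f b \<in> B" "M a u - M 0 u - f a \<in> B"
      unfolding f_def by (rule M; fact * u(1) oku v n0)+
    show ?thesis
      by (rule B_eq[OF B_add[OF 1 B_diff[OF 2]]]) (simp add: algebra_simps)
  qed
  define r where "r w = (if w = 0 then 1 else 0 :: nat)" for w :: nat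
  have r: "r w < n" "allowed (r w) w" for w
    using n5 allowed_neq by (auto simp: r_def)
  define g where "g w = M (r w) w - f (r w)" for w
  have "M a w - (f a + g w) \<in> B" if "a < n" "w < n" "allowed a w" for a w
    by (rule B_eq[OF f[OF r(1) that(1,2) r(2) that(3)]]) (simp add: g_def algebra_simps)
  then show ?thesis by blast
qed

text \<open>
  By \<open>horizontal_edge\<close>, the horizontal edges are loops up to differences of a function \<open>L\<close>, and the
  vertical ones are loops up to differences of a function \<open>K\<close>. The squares say that the mixed differences of
  \<open>L - K\<close> vanish, so \<open>L - K\<close> splits as \<open>f + g\<close>; then \<open>H = L - g = K + f\<close> serves for both directions,
  and a diagonal is composed of a horizontal and a vertical edge.
\<close>

proposition edge_class:
  "\<exists>H. \<forall>a<n. \<forall>a'<n. \<forall>b<n. \<forall>b'<n. allowed a b \<longrightarrow> allowed a b' \<longrightarrow> allowed a' b \<longrightarrow> allowed a' b' \<longrightarrow>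
     e a b a' b' - (base_loop e a a' + base_loop (\<lambda>y x y' x'. e x y x' y') b b' + H a' b' - H a b) \<in> B"
proof -
  interpret S: edge_cocycle B n "\<lambda>u w. allowed w u" "\<lambda>b a b' a'. e a b a' b'"
    by (rule swapped)
  let ?e' = "\<lambda>y x y' x'. e x y x' y'"
  obtain L where L: "\<And>a b w. \<lbrakk>a < n; b < n; w < n; allowed a w; allowed b w\<rbrakk>
      \<Longrightarrow> e a w b w - (base_loop e a b + L b w - L a w) \<in> B"
    using horizontal_edge by (elim exE) blast
  obtain K' where K': "\<And>a b w. \<lbrakk>a < n; b < n; w < n; allowed w a; allowed w b\<rbrakk>
      \<Longrightarrow> e w a w b - (base_loop ?e' a b + K' b w - K' a w) \<in> B"
    using S.horizontal_edge by (elim exE) blast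
  define K where "K a w = K' w a" for a w
  have K: "e w a w b - (base_loop ?e' a b + K w b - K w a) \<in> B"
    if "a < n" "b < n" "w < n" "allowed w a" "allowed w b" for a b w
    using K' that unfolding K_def by blast
  define M where "M a w = L a w - K a w" for a w
  have mixed: "M b w - M a w - (M b w' - M a w') \<in> B"
    if "a < n" "b < n" "w < n" "w' < n" "allowed a w" "allowed b w" "allowed a w'" "allowed b w'" for a b w w'
  proof -
    have 1: "e a w b w + e b w b w' - e a w a w' - e a w' b w' \<in> B"
      using square that by simp
    have 2: "e a w b w - (base_loop e a b + L b w - L a w) \<in> B"
         "e a w' b w' - (base_loop e a b + L b w' - L a w') \<in> B" using L that by auto
    have 3: "e b w b w' - (base_loop ?e' w w' + K b w' - K b w) \<in> B"
         "e a w a w' - (base_loop ?e' w w' + K a w' - K a w) \<in> B" using K that by auto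
    show ?thesis
      by (rule B_eq[OF B_diff[OF 1 B_add[OF B_diff[OF 2] B_diff[OF 3]]]])
         (simp add: M_def algebra_simps)
  qed
  have "\<exists>f g. \<forall>a<n. \<forall>w<n. allowed a w \<longrightarrow> M a w - (f a + g w) \<in> B"
    by (rule split_mixed_difference) (rule mixed)
  then obtain f g where fg: "\<And>a w. \<lbrakk>a < n; w < n; allowed a w\<rbrakk> \<Longrightarrow> M a w - (f a + g w) \<in> B"
    by blast
  define H where "H a w = L a w - g w" for a w
  show ?thesis
  proof (intro exI allI impI)
    fix a a' b b' assume *: "a < n" "a' < n" "b < n" "b' < n" "allowed a b" "allowed a b'" "allowed a' b" "allowed a' b'"
    have 1: "e a b a' b + e a' b a' b' - e a b a' b' \<in> B"
      using * by (intro triangle) (auto simp: card_insert_if)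
    have 2: "e a b a' b - (base_loop e a a' + L a' b - L a b) \<in> B" using L * by simp
    have 3: "e a' b a' b' - (base_loop ?e' b b' + K a' b' - K a' b) \<in> B" using K * by simp
    have 4: "M a' b - (f a' + g b) \<in> B" "M a' b' - (f a' + g b') \<in> B" using fg * by auto
    show "e a b a' b' - (base_loop e a a' + base_loop ?e' b b' + H a' b' - H a b) \<in> B"
      by (rule B_eq[OF B_diff[OF B_add[OF B_add[OF 2 3] B_diff[OF 4]] 1]])
         (simp add: H_def M_def algebra_simps)
  qed
qed

end

section \<open>Affine singular simplices and their boundaries\<close>

type_synonym point = "nat \<Rightarrow> real"

text \<open>
  Taking both components from oriented simplices reduces continuity and faces to the known facts
  about these. Vertices are listed, so that faces arise by omitting list entries.
\<close>

definition affine_simplex :: "nat \<Rightarrow> (point \<times> point) list \<Rightarrow> point \<Rightarrow> point \<times> point" where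
  "affine_simplex p Ps = (\<lambda>t\<in>standard_simplex p.
     (oriented_simplex p (\<lambda>j. fst (Ps ! j)) t, oriented_simplex p (\<lambda>j. snd (Ps ! j)) t))"

definition segment :: "point \<times> point \<Rightarrow> point \<times> point \<Rightarrow> (point \<times> point) chain" where
  "segment P Q = frag_of (affine_simplex 1 [P, Q])"

text \<open>
  The convex hull of three points that may coincide.
\<close>

definition hull3 :: "point \<Rightarrow> point \<Rightarrow> point \<Rightarrow> point set" where
  "hull3 a b c = {\<lambda>i. \<alpha> * a i + \<beta> * b i + \<gamma> * c i | \<alpha> \<beta> \<gamma>. 0 \<le> \<alpha> \<and> 0 \<le> \<beta> \<and> 0 \<le> \<gamma> \<and> \<alpha> + \<beta> + \<gamma> = 1}"

text \<open>
  These are the vertices of the standard simplex as well as, in barycentric coordinates, the vertices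
  of the graph.
\<close>

abbreviation simplex_vertex :: "nat \<Rightarrow> point" where
  "simplex_vertex k \<equiv> (\<lambda>j. if j = k then 1 else 0)"

lemma simplical_face_vertex:
  "simplical_face k (simplex_vertex i) = simplex_vertex (if i < k then i else Suc i)"
  by (auto simp: simplical_face_def fun_eq_iff)

lemma continuous_oriented_simplex: "continuous_on (standard_simplex p) (oriented_simplex p l)"
proof -
  have "singular_simplex p (subtopology (powertop_real UNIV) UNIV) (oriented_simplex p l)"
    by (rule simplicial_imp_singular_simplex) (simp add: simplicial_simplex_oriented_simplex)
  then show ?thesis
    by (simp add: singular_simplex_def euclidean_product_topology)
qed

lemma singular_affine_simplex:
  assumes "affine_simplex p Ps ` standard_simplex p \<subseteq> S"
  shows "singular_simplex p (top_of_set S) (affine_simplex p Ps)"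
proof -
  have "continuous_on (standard_simplex p)
      (\<lambda>t. (oriented_simplex p (\<lambda>j. fst (Ps ! j)) t, oriented_simplex p (\<lambda>j. snd (Ps ! j)) t))"
    by (intro continuous_on_Pair continuous_oriented_simplex)
  then have "continuous_on (standard_simplex p) (affine_simplex p Ps)"
    by (rule continuous_on_eq) (simp add: affine_simplex_def)
  then show ?thesis
    using assms by (auto simp: singular_simplex_def euclidean_product_topology affine_simplex_def)
qed

lemma singular_face_affine_simplex:
  assumes "1 \<le> p" "k \<le> p" "\<And>j. j < p \<Longrightarrow> Qs ! j = Ps ! (if j < k then j else Suc j)"
  shows "singular_face p k (affine_simplex p Ps) = affine_simplex (p - 1) Qs"
proof
  fix t
  have *: "singular_face p k (oriented_simplex p (\<lambda>j. f (Ps ! j))) = oriented_simplex (p - 1) (\<lambda>j. f (Qs ! j))"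
    for f :: "point \<times> point \<Rightarrow> point"
    unfolding singular_face_oriented_simplex[OF assms(1,2)] oriented_simplex_eq
    using assms(1,3) by auto
  show "singular_face p k (affine_simplex p Ps) t = affine_simplex (p - 1) Qs t"
  proof (cases "t \<in> standard_simplex (p - 1)")
    case True
    then have "simplical_face k t \<in> standard_simplex p"
      using assms(1,2) by (simp add: simplical_face_in_standard_simplex)
    then show ?thesis
      using True fun_cong[OF *[of fst], of t] fun_cong[OF *[of snd], of t]
      by (simp add: singular_face_def affine_simplex_def)
  qed (simp add: singular_face_def affine_simplex_def)
qed

lemma affine_simplex_vertex:
  "k \<le> p \<Longrightarrow> affine_simplex p Ps (simplex_vertex k) = Ps ! k"
  by (simp add: affine_simplex_def oriented_simplex_def prod_eq_iff if_distrib cong: if_cong)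

lemma affine_triangle_image:
  "affine_simplex 2 [P, Q, R] ` standard_simplex 2 \<subseteq>
     hull3 (fst P) (fst Q) (fst R) \<times> hull3 (snd P) (snd Q) (snd R)"
proof (clarify, intro conjI SigmaI)
  fix t a b assume t: "t \<in> standard_simplex 2" and ab: "(a, b) = affine_simplex 2 [P, Q, R] t"
  have t3: "0 \<le> t 0" "0 \<le> t 1" "0 \<le> t 2" "t 0 + t 1 + t 2 = 1"
    using t by (simp_all add: standard_simplex_def numeral_2_eq_2)
  have ab': "a = (\<lambda>i. t 0 * fst P i + t 1 * fst Q i + t 2 * fst R i)"
    "b = (\<lambda>i. t 0 * snd P i + t 1 * snd Q i + t 2 * snd R i)"
    using ab t by (simp_all add: affine_simplex_def oriented_simplex_def numeral_2_eq_2 mult.commute)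
  show "a \<in> hull3 (fst P) (fst Q) (fst R)" "b \<in> hull3 (snd P) (snd Q) (snd R)"
    using t3 unfolding hull3_def ab' by blast+
qed

lemma affine_triangle_boundary:
  assumes "hull3 (fst P) (fst Q) (fst R) \<times> hull3 (snd P) (snd Q) (snd R) \<subseteq> S"
  shows "singular_relboundary 1 (top_of_set S) {} (segment P Q + segment Q R - segment P R)"
proof -
  let ?s = "affine_simplex 2 [P, Q, R]"
  have "singular_simplex 2 (top_of_set S) ?s"
    by (rule singular_affine_simplex) (use affine_triangle_image assms in blast)
  then have c: "singular_chain (Suc 1) (top_of_set S) (frag_of ?s)"
    by (simp add: singular_chain_of numeral_2_eq_2)
  have f: "singular_face 2 0 ?s = affine_simplex 1 [Q, R]"
    "singular_face 2 1 ?s = affine_simplex 1 [P, R]"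
    "singular_face 2 2 ?s = affine_simplex 1 [P, Q]"
    using singular_face_affine_simplex[of 2 0 "[Q, R]" "[P, Q, R]"]
      singular_face_affine_simplex[of 2 1 "[P, R]" "[P, Q, R]"]
      singular_face_affine_simplex[of 2 2 "[P, Q]" "[P, Q, R]"]
    by (force simp: less_2_cases_iff)+
  have "chain_boundary (Suc 1) (frag_of ?s) = segment P Q + segment Q R - segment P R"
    using f by (simp add: chain_boundary_of segment_def numeral_2_eq_2)
  with c show ?thesis unfolding singular_boundary by blast
qed

definition point_simplex :: "'a \<Rightarrow> point \<Rightarrow> 'a" where
  "point_simplex x = (\<lambda>t\<in>standard_simplex 0. x)"

lemma singular_face_1:
  "singular_face 1 0 f = point_simplex (f (simplex_vertex 1))"
  "singular_face 1 1 f = point_simplex (f (simplex_vertex 0))"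
  using simplical_face_vertex[of 0 0] simplical_face_vertex[of 1 0]
  by (auto simp: singular_face_def point_simplex_def standard_simplex_0 restrict_def)

lemma chain_boundary_1_of:
  "chain_boundary 1 (frag_of f) =
     frag_of (point_simplex (f (simplex_vertex 1))) - frag_of (point_simplex (f (simplex_vertex 0)))"
  using singular_face_1[of f] by (simp add: chain_boundary_of)

lemma singular_face_2_vertices:
  assumes "k \<le> 2" "i \<le> 1"
  shows "singular_face 2 k f (simplex_vertex i) = f (simplex_vertex (if i < k then i else Suc i))"
  using assms by (simp add: singular_face_def simplical_face_vertex)

lemma chain_boundary_2_of:
  "chain_boundary 2 (frag_of f) =
     frag_of (singular_face 2 0 f) - frag_of (singular_face 2 1 f) + frag_of (singular_face 2 2 f)"
  by (simp add: chain_boundary_of numeral_2_eq_2)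

text \<open>
  The first homology group of a contractible space is trivial.
\<close>

lemma singular_cycle_contractible:
  assumes "contractible_space X" "singular_relcycle 1 X {} c"
  shows "singular_relboundary 1 X {} c"
proof -
  have "trivial_group (homology_group 1 X)"
    using trivial_reduced_homology_group_contractible_space[OF assms(1), of 1]
    by (simp add: un_reduced_homology_group)
  moreover have "homologous_rel_set 1 X {} c \<in> carrier (homology_group 1 X)"
    using assms(2) carrier_relative_homology_group[of 1 X "{}"] by auto
  ultimately have "homologous_rel_set 1 X {} c = singular_relboundary_set 1 X {}"
    using one_relative_homology_group[of 1 X "{}"] by (auto simp: trivial_group_def)
  then show ?thesis by (simp add: homologous_rel_set_eq_relboundary)
qed

text \<open>
  Subdivision is needed with a prescribed number of iterations, so that one number can serve for a
  chain and for its boundary.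
\<close>

lemma iterated_subdivision_homologous:
  assumes "singular_relcycle p X S c"
  shows "homologous_rel p X S c ((singular_subdivision p ^^ m) c)"
proof (induction m)
  case (Suc m)
  have "singular_relcycle p X S ((singular_subdivision p ^^ m) c)"
    using Suc assms homologous_rel_singular_relcycle by blast
  from homologous_rel_singular_subdivision[OF this] Suc show ?case
    by (metis comp_apply funpow.simps(2) homologous_rel_sym homologous_rel_trans)
qed simp

lemma chain_boundary_iterated_subdivision:
  assumes "singular_chain p X c"
  shows "chain_boundary p ((singular_subdivision p ^^ m) c) =
         (singular_subdivision (p - Suc 0) ^^ m) (chain_boundary p c)"
proof -
  have "singular_chain p X ((singular_subdivision p ^^ m) c)" for m
    by (induction m) (auto simp: assms singular_chain_singular_subdivision)
  from chain_boundary_singular_subdivision[OF this] show ?thesis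
    by (induction m) auto
qed

lemma affine_segment_image:
  "affine_simplex 1 [P, Q] ` standard_simplex 1 \<subseteq>
     hull3 (fst P) (fst Q) (fst Q) \<times> hull3 (snd P) (snd Q) (snd Q)"
proof (clarify, intro conjI SigmaI)
  fix t a b assume t: "t \<in> standard_simplex 1" and ab: "(a, b) = affine_simplex 1 [P, Q] t"
  have t2: "0 \<le> t 0" "0 \<le> t 1" "t 0 + t 1 + 0 = 1" "(0::real) \<le> 0"
    using t by (simp_all add: standard_simplex_def)
  have ab': "a = (\<lambda>i. t 0 * fst P i + t 1 * fst Q i + 0 * fst Q i)"
    "b = (\<lambda>i. t 0 * snd P i + t 1 * snd Q i + 0 * snd Q i)"
    using ab t by (simp_all add: affine_simplex_def oriented_simplex_def mult.commute)
  show "a \<in> hull3 (fst P) (fst Q) (fst Q)" "b \<in> hull3 (snd P) (snd Q) (snd Q)"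
    using t2 unfolding hull3_def ab' by blast+
qed

lemma singular_chain_segment:
  assumes "hull3 (fst P) (fst Q) (fst Q) \<times> hull3 (snd P) (snd Q) (snd Q) \<subseteq> S"
  shows "singular_chain 1 (top_of_set S) (segment P Q)"
  unfolding segment_def singular_chain_of
  by (rule singular_affine_simplex) (use affine_segment_image assms in blast)

lemma chain_boundary_segment:
  "chain_boundary 1 (segment P Q) = frag_of (point_simplex Q) - frag_of (point_simplex P)"
  unfolding segment_def chain_boundary_1_of using affine_simplex_vertex[of 0 1 "[P, Q]"]
    affine_simplex_vertex[of 1 1 "[P, Q]"] by simp

lemma convex_combination_in_hull3:
  "t \<in> {0..1} \<Longrightarrow> (\<lambda>i. (1 - t) * x i + t * y i) \<in> hull3 x y y"
  unfolding hull3_def by (intro CollectI exI[of _ "1 - t"] exI[of _ t] exI[of _ 0]) auto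

text \<open>
  Both coordinates move along straight lines towards those of \<open>Q\<close>.
\<close>

lemma contractible_star:
  fixes U :: "(point \<times> point) set"
  assumes U: "\<And>P. P \<in> U \<Longrightarrow> hull3 (fst P) (fst Q) (fst Q) \<times> hull3 (snd P) (snd Q) (snd Q) \<subseteq> U"
    and "U \<noteq> {}"
  shows "contractible_space (top_of_set U)"
proof -
  define h where "h = (\<lambda>(t::real, P::point \<times> point).
    ((\<lambda>i. (1 - t) * fst P i + t * fst Q i), (\<lambda>i. (1 - t) * snd P i + t * snd Q i)))"
  have coord: "continuous_on A (\<lambda>p. fst (snd p) i)" "continuous_on A (\<lambda>p. snd (snd p) i)"
    for A :: "(real \<times> point \<times> point) set" and i
    by (rule continuous_on_product_then_coordinatewise, intro continuous_intros)+
  have "continuous_on ({0..1} \<times> U) h"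
    unfolding h_def case_prod_unfold
    by (intro continuous_on_Pair continuous_on_coordinatewise_then_product continuous_on_add
          continuous_on_mult continuous_on_diff continuous_on_const continuous_on_fst continuous_on_id coord)
  moreover have hU: "h (t, P) \<in> U" if "t \<in> {0..1}" "P \<in> U" for t P
    using U[OF that(2)] convex_combination_in_hull3[OF that(1)] by (auto simp: h_def)
  ultimately have "continuous_map (prod_topology (top_of_set {0..1}) (top_of_set U)) (top_of_set U) h"
    by auto
  moreover have "h (0, P) = id P" "h (1, P) = Q" for P by (simp_all add: h_def)
  ultimately have "homotopic_with (\<lambda>x. True) (top_of_set U) (top_of_set U) id (\<lambda>x. Q)"
    unfolding homotopic_with_def by blast
  then show ?thesis unfolding contractible_space_def by blast
qed

section \<open>The complete graph in barycentric coordinates\<close>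

definition graph_points :: "nat \<Rightarrow> point set" where
  "graph_points n = {x. (\<forall>v. 0 \<le> x v) \<and> {v. x v \<noteq> 0} \<subseteq> {..<n} \<and> card {v. x v \<noteq> 0} \<le> 2 \<and> sum x {..<n} = 1}"

text \<open>
  The type of functions carries the topology of pointwise convergence, so that the realization is a
  subspace of it and continuity of maps into it can be checked coordinatewise.
\<close>

lemma realization_complete_graph: "realization (complete_graph n) = top_of_set (graph_points n)"
proof -
  have "(\<forall>v. 0 \<le> x v) \<and> {v. x v \<noteq> 0} \<in> complete_graph n \<and> (\<Sum>v | x v \<noteq> 0. x v) = 1 \<longleftrightarrow>
      x \<in> graph_points n" for x :: point
  proof (cases "{v. x v \<noteq> 0} \<subseteq> {..<n}")
    case True
    have "(\<Sum>v | x v \<noteq> 0. x v) = sum x {..<n}"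
      by (rule sum.mono_neutral_left) (use True in auto)
    moreover have "{v. x v \<noteq> 0} \<noteq> {}" if "(\<Sum>v | x v \<noteq> 0. x v) = 1"
      using that by (metis sum.empty zero_neq_one)
    ultimately show ?thesis using True by (auto simp: graph_points_def complete_graph_def)
  qed (auto simp: graph_points_def complete_graph_def)
  then show ?thesis
    by (simp add: realization_def euclidean_product_topology)
qed

lemma graph_points_nonneg: "x \<in> graph_points n \<Longrightarrow> 0 \<le> x v"
  by (simp add: graph_points_def)

lemma graph_points_less: "x \<in> graph_points n \<Longrightarrow> 0 < x u \<Longrightarrow> u < n"
  by (force simp: graph_points_def)

lemma graph_points_finite: "x \<in> graph_points n \<Longrightarrow> finite {v. x v \<noteq> 0}"
  by (auto simp: graph_points_def finite_subset)

lemma graph_points_support_card: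
  assumes "x \<in> graph_points n" "\<And>v. v \<in> A \<Longrightarrow> 0 < x v"
  shows "card A \<le> 2"
proof -
  have "A \<subseteq> {v. x v \<noteq> 0}" using assms(2) by fastforce
  then have "card A \<le> card {v. x v \<noteq> 0}"
    by (rule card_mono[OF graph_points_finite[OF assms(1)]])
  then show ?thesis using assms(1) by (simp add: graph_points_def)
qed

lemma graph_points_ex_pos:
  assumes "x \<in> graph_points n" shows "\<exists>u. 0 < x u"
proof (rule ccontr)
  assume "\<not> ?thesis"
  then have "x v = 0" for v using graph_points_nonneg[OF assms, of v] by (metis order_le_less)
  then show False using assms by (simp add: graph_points_def)
qed

lemma vertex_in_graph_points: "u < n \<Longrightarrow> simplex_vertex u \<in> graph_points n"
  by (auto simp: graph_points_def if_distrib cong: if_cong)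

lemma hull3_subset_graph_points:
  assumes x: "x \<in> graph_points n" "y \<in> graph_points n" "z \<in> graph_points n"
    and supp: "\<And>v. v \<notin> A \<Longrightarrow> x v = 0 \<and> y v = 0 \<and> z v = 0" and A: "finite A" "card A \<le> 2"
  shows "hull3 x y z \<subseteq> graph_points n"
proof
  fix p assume "p \<in> hull3 x y z"
  then obtain \<alpha> \<beta> \<gamma> where p: "p = (\<lambda>i. \<alpha> * x i + \<beta> * y i + \<gamma> * z i)"
    "0 \<le> \<alpha>" "0 \<le> \<beta>" "0 \<le> \<gamma>" "\<alpha> + \<beta> + \<gamma> = 1"
    unfolding hull3_def by blast
  have "{v. p v \<noteq> 0} \<subseteq> A" unfolding p(1) using supp by fastforce
  then have "card {v. p v \<noteq> 0} \<le> 2" using A by (meson card_mono le_trans)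
  moreover have "sum p {..<n} = 1"
    using x p(5) by (simp add: p(1) graph_points_def sum.distrib flip: sum_distrib_left)
  moreover have "0 \<le> p v" for v using p(2-4) x by (simp add: p(1) graph_points_nonneg)
  moreover have "{v. p v \<noteq> 0} \<subseteq> {..<n}"
  proof
    fix v assume "v \<in> {v. p v \<noteq> 0}"
    then have "x v \<noteq> 0 \<or> y v \<noteq> 0 \<or> z v \<noteq> 0" by (auto simp: p(1))
    then show "v \<in> {..<n}" using x unfolding graph_points_def by blast
  qed
  ultimately show "p \<in> graph_points n" by (simp add: graph_points_def)
qed

text \<open>
  Both vertices belong to the support of \<open>x\<close>, so all three points lie in one closed edge.
\<close>

lemma hull3_edge_subset:
  assumes "x \<in> graph_points n" "0 < x u" "0 < x u'"
  shows "hull3 x (simplex_vertex u) (simplex_vertex u') \<subseteq> graph_points n"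
proof (rule hull3_subset_graph_points[where A = "{v. x v \<noteq> 0}"])
  show "card {v. x v \<noteq> 0} \<le> 2" using assms(1) by (simp add: graph_points_def)
  show "finite {v. x v \<noteq> 0}" using assms(1) by (rule graph_points_finite)
qed (use assms in \<open>auto intro: vertex_in_graph_points graph_points_less\<close>)

lemma hull3_vertices_subset:
  assumes "{u, u', u''} \<subseteq> {..<n}" "card {u, u', u''} \<le> 2"
  shows "hull3 (simplex_vertex u) (simplex_vertex u') (simplex_vertex u'') \<subseteq> graph_points n"
  by (rule hull3_subset_graph_points[where A = "{u, u', u''}"])
     (use assms in \<open>auto intro: vertex_in_graph_points\<close>)

section \<open>The chain of standard loops carried by a small chain\<close>

text \<open>
  A rounding of points to vertices of the simplex that carries them. It need not be
  continuous: for antisymmetric \<open>t\<close>, another choice changes the cochain below by a coboundary.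
\<close>

definition some_vertex :: "point \<Rightarrow> nat" where
  "some_vertex x = (SOME u. 0 < x u)"

text \<open>
  For two points in the open star of a vertex \<open>u\<close>, this is the value of \<open>t\<close> along the path between
  the vertices that approximate them, by way of \<open>u\<close>. It is used for antisymmetric \<open>t\<close>, when the choice of \<open>u\<close>
  does not matter (\<open>star_cochain\<close>).
\<close>

definition star_cochain :: "(nat \<Rightarrow> nat \<Rightarrow> 'g::ab_group_add) \<Rightarrow> point \<Rightarrow> point \<Rightarrow> 'g" where
  "star_cochain t x y = (let u = SOME u. 0 < x u \<and> 0 < y u in t (some_vertex x) u + t u (some_vertex y))"

lemma some_vertex: "x \<in> graph_points n \<Longrightarrow> 0 < x (some_vertex x)"
  unfolding some_vertex_def by (rule someI_ex) (rule graph_points_ex_pos)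

text \<open>
  Among three vertices of an edge two coincide.
\<close>

lemma add_over_support:
  fixes t :: "nat \<Rightarrow> nat \<Rightarrow> 'g::ab_group_add"
  assumes t: "\<And>a. t a a = 0" "\<And>a b. t b a = - t a b"
    and x: "x \<in> graph_points n" "0 < x a" "0 < x b" "0 < x c"
  shows "t a b + t b c = t a c"
proof -
  have "card {a, b, c} \<le> 2"
    by (rule graph_points_support_card[OF x(1)]) (use x in auto)
  then have "a = b \<or> b = c \<or> a = c" by (auto simp: card_insert_if split: if_splits)
  then show ?thesis using t(1) t(2)[of a b] by auto
qed

text \<open>
  If \<open>w\<close> is another vertex whose star contains both points, then both points lie in the edge
  from \<open>u\<close> to \<open>w\<close>, and the values of \<open>t\<close> add up along its vertices.
\<close>

lemma star_cochain:
  fixes t :: "nat \<Rightarrow> nat \<Rightarrow> 'g::ab_group_add"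
  assumes t: "\<And>a. t a a = 0" "\<And>a b. t b a = - t a b"
    and x: "x \<in> graph_points n" "0 < x u" and y: "y \<in> graph_points n" "0 < y u"
  shows "star_cochain t x y = t (some_vertex x) u + t u (some_vertex y)"
proof -
  define w where "w = (SOME u. 0 < x u \<and> 0 < y u)"
  have w: "0 < x w" "0 < y w"
    using someI[of "\<lambda>u. 0 < x u \<and> 0 < y u" u] x y by (auto simp: w_def)
  have "t (some_vertex x) w = t (some_vertex x) u + t u w"
    by (rule add_over_support[OF t x(1), symmetric]) (use some_vertex x w in auto)
  moreover have "t w (some_vertex y) = t w u + t u (some_vertex y)"
    by (rule add_over_support[OF t y(1), symmetric]) (use some_vertex y w in auto)
  ultimately show ?thesis
    using t(2)[of w u] by (simp add: star_cochain_def w_def[symmetric])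
qed

lemma star_cochain_add:
  fixes t :: "nat \<Rightarrow> nat \<Rightarrow> 'g::ab_group_add"
  assumes t: "\<And>a. t a a = 0" "\<And>a b. t b a = - t a b"
    and "x \<in> graph_points n" "0 < x u" "y \<in> graph_points n" "0 < y u" "z \<in> graph_points n" "0 < z u"
  shows "star_cochain t x y + star_cochain t y z = star_cochain t x z"
proof -
  note sc = star_cochain[OF t, of _ n u]
  show ?thesis
    unfolding sc[OF assms(3-6)] sc[OF assms(5-8)] sc[OF assms(3,4,7,8)]
    using t(2)[of u "some_vertex y"] by simp
qed

text \<open>
  These edges do not mention the ambient space: the same singular simplices serve for the square
  and for the configuration space, and hence so do the loops made of them.
\<close>

definition grid_edge :: "nat \<Rightarrow> nat \<Rightarrow> nat \<Rightarrow> nat \<Rightarrow> (point \<times> point) chain" where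
  "grid_edge u v u' v' = segment (simplex_vertex u, simplex_vertex v) (simplex_vertex u', simplex_vertex v')"

abbreviation loop1 :: "nat \<Rightarrow> nat \<Rightarrow> (point \<times> point) chain" where
  "loop1 \<equiv> base_loop grid_edge"

abbreviation loop2 :: "nat \<Rightarrow> nat \<Rightarrow> (point \<times> point) chain" where
  "loop2 \<equiv> base_loop (\<lambda>y x y' x'. grid_edge x y x' y')"

text \<open>
  The combination of standard loops that a small path from \<open>P\<close> to \<open>Q\<close> contributes.
\<close>

definition loop_cochain :: "point \<times> point \<Rightarrow> point \<times> point \<Rightarrow> (point \<times> point) chain" where
  "loop_cochain P Q = star_cochain loop1 (fst P) (fst Q) + star_cochain loop2 (snd P) (snd Q)"

abbreviation loop_part :: "(point \<times> point) chain \<Rightarrow> (point \<times> point) chain" where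
  "loop_part \<equiv> frag_extend (\<lambda>\<sigma>. loop_cochain (\<sigma> (simplex_vertex 0)) (\<sigma> (simplex_vertex 1)))"

text \<open>
  The three corners of a small triangle lie in a common product of stars, where the cochain is
  additive.
\<close>

lemma loop_part_boundary:
  assumes "Poly_Mapping.keys d \<subseteq>
    {\<tau>. \<exists>u v. \<tau> ` standard_simplex 2 \<subseteq> {P \<in> graph_points n \<times> graph_points n. 0 < fst P u \<and> 0 < snd P v}}"
  shows "loop_part (chain_boundary 2 d) = 0"
  using assms
proof (induction d rule: frag_induction)
  case (one \<tau>)
  then obtain u v where uv: "\<tau> ` standard_simplex 2 \<subseteq>
      {P \<in> graph_points n \<times> graph_points n. 0 < fst P u \<and> 0 < snd P v}" by blast
  let ?P = "\<lambda>i. \<tau> (simplex_vertex i)"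
  have P: "fst (?P i) \<in> graph_points n" "snd (?P i) \<in> graph_points n" "0 < fst (?P i) u" "0 < snd (?P i) v"
    if "i \<le> 2" for i
  proof -
    have "?P i \<in> {P \<in> graph_points n \<times> graph_points n. 0 < fst P u \<and> 0 < snd P v}"
      using uv that by (simp add: image_subset_iff)
    then show "fst (?P i) \<in> graph_points n" "snd (?P i) \<in> graph_points n" "0 < fst (?P i) u" "0 < snd (?P i) v"
      by auto
  qed
  have "loop_cochain (?P 0) (?P 1) + loop_cochain (?P 1) (?P 2) = loop_cochain (?P 0) (?P 2)"
    using P[of 0] P[of 1] P[of 2]
      star_cochain_add[OF base_loop_refl base_loop_swap, of "fst (?P 0)" n u "fst (?P 1)" "fst (?P 2)" grid_edge]
      star_cochain_add[OF base_loop_refl base_loop_swap, of "snd (?P 0)" n v "snd (?P 1)" "snd (?P 2)"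
          "\<lambda>y x y' x'. grid_edge x y x' y'"]
    by (simp add: loop_cochain_def algebra_simps)
  then show ?case
    using singular_face_2_vertices[of 0 0 \<tau>] singular_face_2_vertices[of 0 1 \<tau>]
      singular_face_2_vertices[of 1 0 \<tau>] singular_face_2_vertices[of 1 1 \<tau>]
      singular_face_2_vertices[of 2 0 \<tau>] singular_face_2_vertices[of 2 1 \<tau>]
    unfolding chain_boundary_2_of frag_extend_add frag_extend_diff frag_extend_of
    by (simp add: numeral_2_eq_2 algebra_simps)
qed (simp_all add: chain_boundary_diff frag_extend_diff)

section \<open>Cycles in a space of pairs covered by star-shaped sets\<close>

text \<open>
  \<open>U_star\<close> makes the covering sets star-shaped about pairs of vertices, \<open>U_meet\<close> provides the triangle
  by which the centre can be changed at a point of two covering sets, and \<open>cell_sub\<close> puts the cells of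
  the complex of pairs into the space.
\<close>

locale pair_cover =
  fixes n :: nat and allowed :: "nat \<Rightarrow> nat \<Rightarrow> bool" and S :: "(point \<times> point) set"
    and U :: "nat \<Rightarrow> nat \<Rightarrow> (point \<times> point) set"
  assumes n5: "5 \<le> n"
    and S_sub: "S \<subseteq> graph_points n \<times> graph_points n"
    and allowed_neq: "\<And>u w. u \<noteq> w \<Longrightarrow> allowed u w"
    and U_sub: "\<And>u v. U u v \<subseteq> {P \<in> S. 0 < fst P u \<and> 0 < snd P v \<and> allowed u v}"
    and U_cover: "\<And>P. P \<in> S \<Longrightarrow> \<exists>u v. P \<in> U u v"
    and U_star: "\<And>P u v. P \<in> U u v \<Longrightarrow>
      hull3 (fst P) (simplex_vertex u) (simplex_vertex u) \<times>
      hull3 (snd P) (simplex_vertex v) (simplex_vertex v) \<subseteq> U u v"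
    and U_meet: "\<And>P u v u' v'. \<lbrakk>P \<in> U u v; P \<in> U u' v'\<rbrakk> \<Longrightarrow> allowed u v' \<and>
      hull3 (fst P) (simplex_vertex u) (simplex_vertex u') \<times>
      hull3 (snd P) (simplex_vertex v) (simplex_vertex v') \<subseteq> S"
    and cell_sub: "\<And>a a' a'' b b' b''. \<lbrakk>{a, a', a''} \<subseteq> {..<n}; {b, b', b''} \<subseteq> {..<n};
        card {a, a', a''} \<le> 2; card {b, b', b''} \<le> 2;
        \<forall>x\<in>{a, a', a''}. \<forall>y\<in>{b, b', b''}. allowed x y\<rbrakk> \<Longrightarrow>
      hull3 (simplex_vertex a) (simplex_vertex a') (simplex_vertex a'') \<times>
      hull3 (simplex_vertex b) (simplex_vertex b') (simplex_vertex b'') \<subseteq> S"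
begin

sublocale edge_cocycle "singular_relboundary_set 1 (top_of_set S) {}" n allowed grid_edge
proof (unfold_locales, goal_cases)
  case 5
  then show ?case
    unfolding grid_edge_def mem_Collect_eq
    by (intro affine_triangle_boundary) (simp only: fst_conv snd_conv cell_sub)
qed (use n5 allowed_neq in \<open>simp_all add: singular_relboundary_diff\<close>)

abbreviation base_point :: "nat \<Rightarrow> nat \<Rightarrow> point \<times> point" where
  "base_point u v \<equiv> (simplex_vertex u, simplex_vertex v)"

text \<open>
  Together with the segments from its ends to the centre, the simplex forms a cycle in the contractible
  space \<open>U u v\<close>.
\<close>

lemma small_simplex_homologous:
  assumes \<sigma>: "singular_simplex 1 (top_of_set S) \<sigma>" and U: "\<sigma> ` standard_simplex 1 \<subseteq> U u v"
  shows "singular_relboundary 1 (top_of_set S) {} (frag_of \<sigma> -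
     (segment (\<sigma> (simplex_vertex 0)) (base_point u v) - segment (\<sigma> (simplex_vertex 1)) (base_point u v)))"
    (is "singular_relboundary 1 _ {} ?c")
proof -
  have P: "\<sigma> (simplex_vertex i) \<in> U u v" if "i \<le> 1" for i
    using U that by (simp add: image_subset_iff)
  have US: "U u v \<subseteq> S" using U_sub by blast
  have "singular_simplex 1 (top_of_set (U u v)) \<sigma>"
    using \<sigma> U by (simp add: singular_simplex_subtopology)
  moreover have "singular_chain 1 (top_of_set (U u v)) (segment (\<sigma> (simplex_vertex i)) (base_point u v))"
    if "i \<le> 1" for i
    using U_star[OF P[OF that]] by (intro singular_chain_segment) simp
  ultimately have "singular_chain 1 (top_of_set (U u v)) ?c"
    by (intro singular_chain_diff) (simp_all add: singular_chain_of)
  moreover have "chain_boundary 1 ?c = 0"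
    unfolding chain_boundary_diff chain_boundary_segment chain_boundary_1_of by simp
  ultimately have "singular_relcycle 1 (top_of_set (U u v)) {} ?c"
    by (simp add: singular_cycle)
  moreover have "contractible_space (top_of_set (U u v))"
    by (rule contractible_star[where Q = "base_point u v"]) (use U_star P[of 0] in auto)
  ultimately have "singular_relboundary 1 (top_of_set (U u v)) {} ?c"
    by (intro singular_cycle_contractible)
  then show ?thesis using singular_boundary_mono[OF US] by blast
qed

lemma change_base_point:
  assumes "P \<in> U u v" "P \<in> U u' v'"
  shows "singular_relboundary 1 (top_of_set S) {}
    (segment P (base_point u v) + grid_edge u v u' v' - segment P (base_point u' v'))"
  unfolding grid_edge_def
  by (rule affine_triangle_boundary) (use U_meet[OF assms] in simp)

text \<open>
  For each small simplex \<open>\<sigma>\<close> the chain \<open>\<sigma>\<close> differs from its loop part by \<open>k P - k Q\<close> up to boundaries,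
  where \<open>P\<close> and \<open>Q\<close> are the ends of \<open>\<sigma>\<close>, and \<open>k\<close> is a function on \<open>S\<close> that does not depend on \<open>\<sigma>\<close>. Over a
  cycle these differences cancel.
\<close>

proposition small_cycle_homologous_loop_part:
  assumes c: "singular_relcycle 1 (top_of_set S) {} c"
    and small: "\<And>\<sigma>. \<sigma> \<in> Poly_Mapping.keys c \<Longrightarrow> \<exists>u v. \<sigma> ` standard_simplex 1 \<subseteq> U u v"
  shows "singular_relboundary 1 (top_of_set S) {} (c - loop_part c)"
proof -
  let ?B = "singular_relboundary_set 1 (top_of_set S) {}"
  obtain H where H: "\<And>a a' b b'. \<lbrakk>a < n; a' < n; b < n; b' < n; allowed a b; allowed a b'; allowed a' b; allowed a' b'\<rbrakk> \<Longrightarrow>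
     grid_edge a b a' b' - (loop1 a a' + loop2 b b' + H a' b' - H a b) \<in> ?B"
    using edge_class by (elim exE) blast
  obtain M N where MN: "\<And>P. P \<in> S \<Longrightarrow> P \<in> U (M P) (N P)"
    using U_cover by metis
  \<comment> \<open>The function \<open>k\<close> leads from a point to the centre of its chosen covering set, corrects by the
  function \<open>H\<close> there, and compares that centre with the vertices used by the cochain.\<close>
  define k where "k P = segment P (base_point (M P) (N P)) - H (M P) (N P)
      + loop1 (M P) (some_vertex (fst P)) + loop2 (N P) (some_vertex (snd P))" for P
  define K where "K s = k (s (simplex_vertex 0))" for s :: "point \<Rightarrow> point \<times> point"
  have point: "segment P (base_point u v) -
      (k P + loop1 (some_vertex (fst P)) u + loop2 (some_vertex (snd P)) v + H u v) \<in> ?B"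
    if P: "P \<in> U u v" for P u v
  proof -
    have PS: "P \<in> S" "0 < fst P u" "0 < snd P v" "allowed u v" using P U_sub by auto
    let ?a = "M P" and ?b = "N P"
    have P': "P \<in> U ?a ?b" using MN PS by simp
    have PM: "0 < fst P ?a" "0 < snd P ?b" "allowed ?a ?b" using P' U_sub by auto
    have G: "fst P \<in> graph_points n" "snd P \<in> graph_points n" using PS S_sub by auto
    have allowed: "allowed ?a v" "allowed u ?b" using U_meet[OF P P'] U_meet[OF P' P] by auto
    have less: "?a < n" "u < n" "?b < n" "v < n"
      using G PS PM graph_points_less by blast+
    note 1 = H[OF less PM(3) allowed PS(4)]
    have 2: "segment P (base_point ?a ?b) + grid_edge ?a ?b u v - segment P (base_point u v) \<in> ?B"
      using change_base_point[OF P' P] by simp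
    have 3: "loop1 ?a (some_vertex (fst P)) + loop1 (some_vertex (fst P)) u = loop1 ?a u"
      by (rule add_over_support[OF base_loop_refl base_loop_swap G(1)])
         (use PM PS some_vertex[OF G(1)] in auto)
    have 4: "loop2 ?b (some_vertex (snd P)) + loop2 (some_vertex (snd P)) v = loop2 ?b v"
      by (rule add_over_support[OF base_loop_refl base_loop_swap G(2)])
         (use PM PS some_vertex[OF G(2)] in auto)
    show ?thesis
      by (rule B_eq[OF B_diff[OF 1 2]]) (simp add: k_def 3[symmetric] 4[symmetric] algebra_simps)
  qed
  \<comment> \<open>For arbitrary small chains the differences \<open>k P - k Q\<close> form a function of the boundary.\<close>
  have main: "frag_of \<sigma> - loop_part (frag_of \<sigma>) + frag_extend K (chain_boundary 1 (frag_of \<sigma>)) \<in> ?B"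
    if \<sigma>: "singular_simplex 1 (top_of_set S) \<sigma>" "\<sigma> ` standard_simplex 1 \<subseteq> U u v" for \<sigma> u v
  proof -
    let ?P = "\<sigma> (simplex_vertex 0)" and ?Q = "\<sigma> (simplex_vertex 1)"
    have PQ: "?P \<in> U u v" "?Q \<in> U u v" using \<sigma>(2) by (simp_all add: image_subset_iff)
    have G: "fst ?P \<in> graph_points n" "snd ?P \<in> graph_points n"
            "fst ?Q \<in> graph_points n" "snd ?Q \<in> graph_points n"
      and pos: "0 < fst ?P u" "0 < snd ?P v" "0 < fst ?Q u" "0 < snd ?Q v"
      using PQ U_sub[of u v] S_sub by (auto simp: mem_Times_iff)
    have 0: "frag_of \<sigma> - (segment ?P (base_point u v) - segment ?Q (base_point u v)) \<in> ?B"
      using small_simplex_homologous[OF \<sigma>] by simp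
    have bd: "frag_extend K (chain_boundary 1 (frag_of \<sigma>)) = k ?Q - k ?P"
      unfolding chain_boundary_1_of frag_extend_diff frag_extend_of
      by (simp add: K_def point_simplex_def)
    have lc: "loop_part (frag_of \<sigma>) = loop1 (some_vertex (fst ?P)) u - loop1 (some_vertex (fst ?Q)) u
        + loop2 (some_vertex (snd ?P)) v - loop2 (some_vertex (snd ?Q)) v"
      unfolding frag_extend_of loop_cochain_def
        star_cochain[OF base_loop_refl base_loop_swap G(1) pos(1) G(3) pos(3)]
        star_cochain[OF base_loop_refl base_loop_swap G(2) pos(2) G(4) pos(4)]
        base_loop_swap[of _ "some_vertex (fst ?Q)" u] base_loop_swap[of _ "some_vertex (snd ?Q)" v]
      by simp
    show ?thesis
      unfolding bd lc
      by (rule B_eq[OF B_add[OF 0 B_diff[OF point[OF PQ(1)] point[OF PQ(2)]]]]) (simp add: algebra_simps)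
  qed
  have "Poly_Mapping.keys c \<subseteq>
      {\<sigma>. singular_simplex 1 (top_of_set S) \<sigma> \<and> (\<exists>u v. \<sigma> ` standard_simplex 1 \<subseteq> U u v)}"
    using c small by (auto simp: singular_cycle singular_chain_def)
  then have "c - loop_part c + frag_extend K (chain_boundary 1 c) \<in> ?B"
  proof (induction c rule: frag_induction)
    case zero
    show ?case using B_zero by simp
  next
    case (one \<sigma>)
    then show ?case using main by blast
  next
    case (diff a b)
    from B_diff[OF diff] show ?case
      by (rule B_eq) (simp add: frag_extend_diff chain_boundary_diff algebra_simps)
  qed
  then show ?thesis using c by (simp add: singular_cycle)
qed

lemma triangle_loop_cycle:
  assumes "a < n" "b < n" "c < n" "w < n" "w \<notin> {a, b, c}"
  shows "triangle_loop grid_edge a b c w \<in> singular_relcycle_set 1 (top_of_set S) {}"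
    "triangle_loop (\<lambda>y x y' x'. grid_edge x y x' y') a b c w \<in> singular_relcycle_set 1 (top_of_set S) {}"
proof -
  have "singular_chain 1 (top_of_set S) (grid_edge a w b w)"
    "singular_chain 1 (top_of_set S) (grid_edge w a w b)" if "a < n" "b < n" "w \<notin> {a, b}" for a b
  proof -
    have sub: "{a, b, b} \<subseteq> {..<n}" "{w, w, w} \<subseteq> {..<n}" "card {a, b, b} \<le> 2" "card {w, w, w} \<le> 2"
      using that assms(4) by (auto simp: card_insert_if)
    have allowed: "\<forall>x\<in>{a, b, b}. \<forall>y\<in>{w, w, w}. allowed x y" "\<forall>x\<in>{w, w, w}. \<forall>y\<in>{a, b, b}. allowed x y"
      using that allowed_neq by auto
    show "singular_chain 1 (top_of_set S) (grid_edge a w b w)"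
      unfolding grid_edge_def
      by (rule singular_chain_segment) (unfold fst_conv snd_conv, rule cell_sub[OF sub allowed(1)])
    show "singular_chain 1 (top_of_set S) (grid_edge w a w b)"
      unfolding grid_edge_def
      by (rule singular_chain_segment) (unfold fst_conv snd_conv, rule cell_sub[OF sub(2,1,4,3) allowed(2)])
  qed
  moreover have "chain_boundary 1 (grid_edge a b a' b') =
      frag_of (point_simplex (base_point a' b')) - frag_of (point_simplex (base_point a b))" for a b a' b'
    unfolding grid_edge_def chain_boundary_segment ..
  ultimately show "triangle_loop grid_edge a b c w \<in> singular_relcycle_set 1 (top_of_set S) {}"
    "triangle_loop (\<lambda>y x y' x'. grid_edge x y x' y') a b c w \<in> singular_relcycle_set 1 (top_of_set S) {}"
    using assms unfolding triangle_loop_def singular_cycle chain_boundary_add mem_Collect_eq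
    by (simp_all add: singular_chain_add)
qed

text \<open>
  With \<open>S\<close> the configuration space this is what carries classes of the square back to it.
\<close>

lemma base_loop_cycle:
  assumes "a < n" "b < n"
  shows "singular_relcycle 1 (top_of_set S) {} (loop1 a b)"
    "singular_relcycle 1 (top_of_set S) {} (loop2 a b)"
proof -
  let ?Z = "singular_relcycle_set 1 (top_of_set S) {}"
  have "loop1 a b \<in> ?Z"
    by (rule base_loop_closed[OF n5 assms])
       (simp_all add: singular_relcycle_minus triangle_loop_cycle[simplified])
  moreover have "loop2 a b \<in> ?Z"
    by (rule base_loop_closed[OF n5 assms])
       (simp_all add: singular_relcycle_minus triangle_loop_cycle[simplified])
  ultimately show "singular_relcycle 1 (top_of_set S) {} (loop1 a b)"
    "singular_relcycle 1 (top_of_set S) {} (loop2 a b)" by auto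
qed

text \<open>
  The hypothesis is smallness with respect to the square, whereas \<open>S\<close> may be the configuration space.
\<close>

lemma loop_part_cycle:
  assumes "Poly_Mapping.keys c \<subseteq>
    {\<sigma>. \<exists>u v. \<sigma> ` standard_simplex 1 \<subseteq> {P \<in> graph_points n \<times> graph_points n. 0 < fst P u \<and> 0 < snd P v}}"
  shows "singular_relcycle 1 (top_of_set S) {} (loop_part c)"
  using assms
proof (induction c rule: frag_induction)
  case (one \<sigma>)
  then obtain u v where uv: "\<sigma> ` standard_simplex 1 \<subseteq>
      {P \<in> graph_points n \<times> graph_points n. 0 < fst P u \<and> 0 < snd P v}" by blast
  let ?P = "\<sigma> (simplex_vertex 0)" and ?Q = "\<sigma> (simplex_vertex 1)"
  have "?P \<in> {P \<in> graph_points n \<times> graph_points n. 0 < fst P u \<and> 0 < snd P v}"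
       "?Q \<in> {P \<in> graph_points n \<times> graph_points n. 0 < fst P u \<and> 0 < snd P v}"
    using uv by (simp_all add: image_subset_iff)
  then have G: "fst ?P \<in> graph_points n" "snd ?P \<in> graph_points n"
            "fst ?Q \<in> graph_points n" "snd ?Q \<in> graph_points n"
      and pos: "0 < fst ?P u" "0 < snd ?P v" "0 < fst ?Q u" "0 < snd ?Q v"
    by auto
  show ?case
    unfolding frag_extend_of loop_cochain_def
      star_cochain[OF base_loop_refl base_loop_swap G(1) pos(1) G(3) pos(3)]
      star_cochain[OF base_loop_refl base_loop_swap G(2) pos(2) G(4) pos(4)]
    by (intro singular_relcycle_add base_loop_cycle)
       (use G pos some_vertex graph_points_less in blast)+
qed (simp_all add: frag_extend_diff singular_relcycle_diff)

end

section \<open>Coverings of the square and of the configuration space\<close>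

text \<open>
  A linear inequality that holds at three points holds on their convex hull. The functionals
  \<open>\<lambda>x. sum x A\<close> are the ones that separate the two coordinates of a pair below.
\<close>

lemma hull3_sum_ge:
  assumes "p \<in> hull3 x y z" "m \<le> sum x A" "m \<le> sum y A" "m \<le> sum z A"
  shows "m \<le> sum p A"
proof -
  obtain \<alpha> \<beta> \<gamma> where p: "p = (\<lambda>i. \<alpha> * x i + \<beta> * y i + \<gamma> * z i)"
    "0 \<le> \<alpha>" "0 \<le> \<beta>" "0 \<le> \<gamma>" "\<alpha> + \<beta> + \<gamma> = 1"
    using assms(1) unfolding hull3_def by blast
  have "m = \<alpha> * m + \<beta> * m + \<gamma> * m" using p(5) by (simp flip: distrib_right)
  also have "\<dots> \<le> \<alpha> * sum x A + \<beta> * sum y A + \<gamma> * sum z A"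
    using assms p by (intro add_mono mult_left_mono)
  also have "\<dots> = sum p A" by (simp add: p(1) sum.distrib sum_distrib_left)
  finally show ?thesis .
qed

lemma hull3_sum_le:
  assumes "p \<in> hull3 x y z" "sum x A \<le> m" "sum y A \<le> m" "sum z A \<le> m"
  shows "sum p A \<le> m"
proof -
  obtain \<alpha> \<beta> \<gamma> where p: "p = (\<lambda>i. \<alpha> * x i + \<beta> * y i + \<gamma> * z i)"
    "0 \<le> \<alpha>" "0 \<le> \<beta>" "0 \<le> \<gamma>" "\<alpha> + \<beta> + \<gamma> = 1"
    using assms(1) unfolding hull3_def by blast
  have "sum p A = \<alpha> * sum x A + \<beta> * sum y A + \<gamma> * sum z A"
    by (simp add: p(1) sum.distrib sum_distrib_left)
  also have "\<dots> \<le> \<alpha> * m + \<beta> * m + \<gamma> * m"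
    using assms p by (intro add_mono mult_left_mono)
  also have "\<dots> = m" using p(5) by (simp flip: distrib_right)
  finally show ?thesis .
qed

lemma graph_points_sum_le_1:
  assumes "x \<in> graph_points n" "A \<subseteq> {..<n}" shows "sum x A \<le> 1"
proof -
  have "sum x A \<le> sum x {..<n}"
    by (rule sum_mono2) (use assms graph_points_nonneg in auto)
  then show ?thesis using assms by (simp add: graph_points_def)
qed

lemma vertex_sum: "finite A \<Longrightarrow> sum (simplex_vertex u) A = (if u \<in> A then 1 else 0)"
  by simp

text \<open>
  Both points have coordinate sum one.
\<close>

lemma graph_points_ex_less:
  assumes "x \<in> graph_points n" "y \<in> graph_points n" "x \<noteq> y"
  shows "\<exists>u. y u < x u"
proof (rule ccontr)
  assume "\<not> ?thesis"
  then have le: "x u \<le> y u" for u by (meson not_le)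
  obtain v where "x v \<noteq> y v" using assms(3) by blast
  with le have v: "x v < y v" by (simp add: order_less_le)
  then have "v < n" using graph_points_less[OF assms(2), of v] graph_points_nonneg[OF assms(1), of v] by linarith
  then have "sum x {..<n} < sum y {..<n}"
    by (intro sum_strict_mono_ex1) (use le v in auto)
  then show False using assms by (simp add: graph_points_def)
qed

lemma pair_cover_product:
  assumes "5 \<le> n"
  shows "pair_cover n (\<lambda>_ _. True) (graph_points n \<times> graph_points n)
    (\<lambda>u v. {P \<in> graph_points n \<times> graph_points n. 0 < fst P u \<and> 0 < snd P v})"
proof (unfold_locales, goal_cases)
  case (5 P)
  then show ?case using graph_points_ex_pos by (force simp: mem_Times_iff)
next
  case (6 P u v)
  have "0 < p u" if p: "p \<in> hull3 x (simplex_vertex u) (simplex_vertex u)" and x: "x \<in> graph_points n" "0 < x u"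
    for p x u
    using hull3_sum_ge[OF p, of "x u" "{u}"] x graph_points_sum_le_1[OF x(1), of "{u}"]
      graph_points_less[OF x] by simp
  moreover have "hull3 x (simplex_vertex u) (simplex_vertex u) \<subseteq> graph_points n"
    if "x \<in> graph_points n" "0 < x u" for x u
    by (rule hull3_edge_subset[OF that that(2)])
  ultimately show ?case using 6 by (fastforce simp: mem_Times_iff)
next
  case (7 P u v u' v')
  then show ?case using hull3_edge_subset by (auto simp: mem_Times_iff subset_iff)
next
  case (8 a a' a'' b b' b'')
  then show ?case by (intro Sigma_mono hull3_vertices_subset)
qed (use assms in auto)

definition off_diagonal :: "nat \<Rightarrow> (point \<times> point) set" where
  "off_diagonal n = {P \<in> graph_points n \<times> graph_points n. fst P \<noteq> snd P}"

text \<open>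
  The hypotheses \<open>U_meet\<close> and \<open>cell_sub\<close> demand that the two coordinates remain distinct. This is seen
  from the total weight on the vertices that occur for the first coordinate: it does not decrease when the
  first coordinate moves towards such vertices, and does not increase when the second coordinate moves towards
  vertices outside this set.
\<close>

lemma pair_cover_off_diagonal:
  assumes "5 \<le> n"
  shows "pair_cover n (\<lambda>u v. u \<noteq> v) (off_diagonal n)
    (\<lambda>u v. {P \<in> off_diagonal n. snd P u < fst P u \<and> fst P v < snd P v})"
proof (unfold_locales, goal_cases)
  case (4 u v)
  have "0 < fst P u" "0 < snd P v" if "P \<in> off_diagonal n" "snd P u < fst P u" "fst P v < snd P v" for P
    using that graph_points_nonneg[of "fst P" n v] graph_points_nonneg[of "snd P" n u]
    by (auto simp: off_diagonal_def mem_Times_iff)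
  then show ?case by auto
next
  case (5 P)
  then have P: "fst P \<in> graph_points n" "snd P \<in> graph_points n" "fst P \<noteq> snd P"
    by (auto simp: off_diagonal_def)
  from graph_points_ex_less[OF P] graph_points_ex_less[OF P(2,1) P(3)[symmetric]] 5
  show ?case by blast
next
  case (6 P u v)
  then have P: "fst P \<in> graph_points n" "snd P \<in> graph_points n" "snd P u < fst P u" "fst P v < snd P v" "u \<noteq> v"
    by (auto simp: off_diagonal_def)
  have pos: "0 < fst P u" "0 < snd P v"
    using P graph_points_nonneg[of "fst P" n v] graph_points_nonneg[of "snd P" n u] by auto
  have less: "u < n" "v < n" using graph_points_less P pos by blast+
  show ?case
  proof
    fix Q assume "Q \<in> hull3 (fst P) (simplex_vertex u) (simplex_vertex u) \<times>
        hull3 (snd P) (simplex_vertex v) (simplex_vertex v)"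
    then have Q: "fst Q \<in> hull3 (fst P) (simplex_vertex u) (simplex_vertex u)"
       "snd Q \<in> hull3 (snd P) (simplex_vertex v) (simplex_vertex v)" by auto
    have "fst Q \<in> graph_points n" "snd Q \<in> graph_points n"
      using Q hull3_edge_subset P pos by blast+
    moreover have "fst P u \<le> fst Q u" "snd P v \<le> snd Q v"
      using hull3_sum_ge[OF Q(1), of "fst P u" "{u}"] hull3_sum_ge[OF Q(2), of "snd P v" "{v}"]
        graph_points_sum_le_1[OF P(1), of "{u}"] graph_points_sum_le_1[OF P(2), of "{v}"] less
      by auto
    moreover have "snd Q u \<le> snd P u" "fst Q v \<le> fst P v"
      using hull3_sum_le[OF Q(2), of "{u}" "snd P u"] hull3_sum_le[OF Q(1), of "{v}" "fst P v"]
        graph_points_nonneg[OF P(1), of v] graph_points_nonneg[OF P(2), of u] P(5)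
      by auto
    ultimately have "fst Q \<in> graph_points n" "snd Q \<in> graph_points n" "snd Q u < fst Q u" "fst Q v < snd Q v"
      using P by auto
    then show "Q \<in> {P \<in> off_diagonal n. snd P u < fst P u \<and> fst P v < snd P v}"
      by (auto simp: off_diagonal_def mem_Times_iff)
  qed
next
  case (7 P u v u' v')
  then have P: "fst P \<in> graph_points n" "snd P \<in> graph_points n" "snd P u < fst P u" "fst P v < snd P v"
     "snd P u' < fst P u'" "fst P v' < snd P v'"
    by (auto simp: off_diagonal_def)
  then have neq: "u \<noteq> v" "u \<noteq> v'" "u' \<noteq> v" "u' \<noteq> v'" by auto
  have pos: "0 < fst P u" "0 < snd P v" "0 < fst P u'" "0 < snd P v'"
    using P graph_points_nonneg[OF P(1)] graph_points_nonneg[OF P(2)] by (meson le_less_trans)+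
  have less: "u < n" "v < n" "u' < n" "v' < n" using graph_points_less P pos by blast+
  let ?A = "{u, u'}"
  have gt: "sum (snd P) ?A < sum (fst P) ?A"
    by (rule sum_strict_mono) (use P in auto)
  have "Q \<in> off_diagonal n"
    if Q: "fst Q \<in> hull3 (fst P) (simplex_vertex u) (simplex_vertex u')"
       "snd Q \<in> hull3 (snd P) (simplex_vertex v) (simplex_vertex v')" for Q
  proof -
    have G: "fst Q \<in> graph_points n" "snd Q \<in> graph_points n"
      using Q hull3_edge_subset P pos by blast+
    have A1: "sum (fst P) ?A \<le> 1" using graph_points_sum_le_1[OF P(1), of ?A] less by simp
    have A0: "0 \<le> sum (snd P) ?A" using graph_points_nonneg[OF P(2)] by (simp add: sum_nonneg)
    have "sum (fst P) ?A \<le> sum (fst Q) ?A"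
      by (rule hull3_sum_ge[OF Q(1)]) (use A1 in \<open>simp_all only: vertex_sum finite.intros insert_iff simp_thms if_True\<close>)
    moreover have "sum (snd Q) ?A \<le> sum (snd P) ?A"
      by (rule hull3_sum_le[OF Q(2)])
        (use A0 neq[THEN not_sym] in \<open>simp_all only: vertex_sum finite.intros insert_iff empty_iff simp_thms if_False\<close>)
    ultimately have "fst Q \<noteq> snd Q" using gt by force
    with G show ?thesis by (simp add: off_diagonal_def mem_Times_iff)
  qed
  then show ?case using neq by auto
next
  case (8 a a' a'' b b' b'')
  let ?A = "{a, a', a''}"
  show ?case
  proof
    fix Q assume "Q \<in> hull3 (simplex_vertex a) (simplex_vertex a') (simplex_vertex a'') \<times>
        hull3 (simplex_vertex b) (simplex_vertex b') (simplex_vertex b'')"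
    then have Q: "fst Q \<in> hull3 (simplex_vertex a) (simplex_vertex a') (simplex_vertex a'')"
       "snd Q \<in> hull3 (simplex_vertex b) (simplex_vertex b') (simplex_vertex b'')" by auto
    have G: "fst Q \<in> graph_points n" "snd Q \<in> graph_points n"
      using Q hull3_vertices_subset 8(1-4) by blast+
    have neq: "b \<notin> ?A" "b' \<notin> ?A" "b'' \<notin> ?A" using 8(5) by auto
    have fin: "finite ?A" by simp
    have "1 \<le> sum (fst Q) ?A"
      by (rule hull3_sum_ge[OF Q(1)]) (unfold vertex_sum[OF fin], auto)
    moreover have "sum (snd Q) ?A \<le> 0"
      by (rule hull3_sum_le[OF Q(2)]) (unfold vertex_sum[OF fin], use neq in auto)
    ultimately have "fst Q \<noteq> snd Q" by force
    with G show "Q \<in> off_diagonal n" by (simp add: off_diagonal_def mem_Times_iff)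
  qed
qed (use assms in \<open>auto simp: off_diagonal_def\<close>)

section \<open>Comparison of the first homology groups\<close>

lemma config_space2_graph_points:
  "config_space2 (top_of_set (graph_points n)) = top_of_set (off_diagonal n)"
proof -
  have "(graph_points n \<times> graph_points n) \<inter> {(x, y). x \<noteq> y} = off_diagonal n"
    by (auto simp: off_diagonal_def)
  then show ?thesis
    by (simp add: config_space2_def subtopology_subtopology)
qed

lemma continuous_coordinates:
  "continuous_on UNIV (\<lambda>P :: point \<times> point. fst P i)" "continuous_on UNIV (\<lambda>P :: point \<times> point. snd P i)"
  by (rule continuous_on_product_then_coordinatewise, intro continuous_intros)+

lemma openin_product_star:
  "openin (top_of_set (graph_points n \<times> graph_points n))
     {P \<in> graph_points n \<times> graph_points n. 0 < fst P u \<and> 0 < snd P v}"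
proof -
  have "open ({P :: point \<times> point. 0 < fst P u} \<inter> {P. 0 < snd P v})"
    by (intro open_Int open_Collect_less continuous_coordinates continuous_on_const)
  then have "openin (top_of_set (graph_points n \<times> graph_points n))
      ((graph_points n \<times> graph_points n) \<inter> ({P :: point \<times> point. 0 < fst P u} \<inter> {P. 0 < snd P v}))"
    by (rule openin_open_Int)
  then show ?thesis by (simp add: Int_def)
qed

lemma openin_off_diagonal_star:
  "openin (top_of_set (off_diagonal n)) {P \<in> off_diagonal n. snd P u < fst P u \<and> fst P v < snd P v}"
proof -
  have "open ({P :: point \<times> point. snd P u < fst P u} \<inter> {P. fst P v < snd P v})"
    by (intro open_Int open_Collect_less continuous_coordinates)
  then have "openin (top_of_set (off_diagonal n))
      (off_diagonal n \<inter> ({P :: point \<times> point. snd P u < fst P u} \<inter> {P. fst P v < snd P v}))"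
    by (rule openin_open_Int)
  then show ?thesis by (simp add: Int_def)
qed

text \<open>
  Surjectivity: make the cycle small and replace it by its loop part.
\<close>

lemma product_cycle_homologous_off_diagonal:
  assumes n: "5 \<le> n" and c: "singular_relcycle 1 (top_of_set (graph_points n \<times> graph_points n)) {} c"
  shows "\<exists>c'. singular_relcycle 1 (top_of_set (off_diagonal n)) {} c' \<and>
     homologous_rel 1 (top_of_set (graph_points n \<times> graph_points n)) {} c c'"
proof -
  let ?X = "graph_points n \<times> graph_points n"
  let ?U = "\<lambda>u v. {P \<in> ?X. 0 < fst P u \<and> 0 < snd P v}"
  interpret X: pair_cover n "\<lambda>_ _. True" ?X ?U by (rule pair_cover_product[OF n])
  interpret F: pair_cover n "\<lambda>u v. u \<noteq> v" "off_diagonal n"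
    "\<lambda>u v. {P \<in> off_diagonal n. snd P u < fst P u \<and> fst P v < snd P v}"
    by (rule pair_cover_off_diagonal[OF n])
  obtain c' where c': "singular_relcycle 1 (top_of_set ?X) {} c'" "homologous_rel 1 (top_of_set ?X) {} c c'"
    and small: "\<And>f. f \<in> Poly_Mapping.keys c' \<Longrightarrow> \<exists>V\<in>range (case_prod ?U). f \<in> standard_simplex 1 \<rightarrow> V"
  proof (rule small_homologous_rel_relcycle_exists[of "range (case_prod ?U)", OF _ _ c])
    show "openin (top_of_set ?X) V" if "V \<in> range (case_prod ?U)" for V
      using that openin_product_star by auto
    show "topspace (top_of_set ?X) \<subseteq> \<Union> (range (case_prod ?U))"
      using X.U_cover by auto
  qed blast
  then have small': "\<exists>u v. f ` standard_simplex 1 \<subseteq> ?U u v" if "f \<in> Poly_Mapping.keys c'" for f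
    using small[OF that] by (auto simp: Pi_iff image_subset_iff)
  have "homologous_rel 1 (top_of_set ?X) {} c' (loop_part c')"
    unfolding homologous_rel_def using X.small_cycle_homologous_loop_part[OF c'(1) small'] .
  then have "homologous_rel 1 (top_of_set ?X) {} c (loop_part c')"
    using c'(2) homologous_rel_trans by blast
  moreover have "singular_relcycle 1 (top_of_set (off_diagonal n)) {} (loop_part c')"
    by (rule F.loop_part_cycle) (use small' in blast)
  ultimately show ?thesis by blast
qed

text \<open>
  Injectivity. The cycle is made small for the covering of the configuration space, and a chain that
  it bounds in the square is made small for the covering of the square, by the same number of subdivisions.
  Then the cycle is homologous to its loop part, which is zero.
\<close>

lemma off_diagonal_boundary:
  assumes n: "5 \<le> n" and c: "singular_relcycle 1 (top_of_set (off_diagonal n)) {} c"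
    and b: "singular_relboundary 1 (top_of_set (graph_points n \<times> graph_points n)) {} c"
  shows "singular_relboundary 1 (top_of_set (off_diagonal n)) {} c"
proof -
  let ?X = "graph_points n \<times> graph_points n"
  let ?U = "\<lambda>u v. {P \<in> ?X. 0 < fst P u \<and> 0 < snd P v}"
  let ?V = "\<lambda>u v. {P \<in> off_diagonal n. snd P u < fst P u \<and> fst P v < snd P v}"
  interpret X: pair_cover n "\<lambda>_ _. True" ?X ?U by (rule pair_cover_product[OF n])
  interpret F: pair_cover n "\<lambda>u v. u \<noteq> v" "off_diagonal n" ?V
    by (rule pair_cover_off_diagonal[OF n])
  obtain d where d: "singular_chain 2 (top_of_set ?X) d" "chain_boundary 2 d = c"
    using b by (auto simp: singular_boundary numeral_2_eq_2)
  obtain k where k: "\<And>m f. \<lbrakk>k \<le> m; f \<in> Poly_Mapping.keys ((singular_subdivision 2 ^^ m) d)\<rbrakk>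
      \<Longrightarrow> \<exists>W\<in>range (case_prod ?U). f \<in> standard_simplex 2 \<rightarrow> W"
  proof (rule sufficient_iterated_singular_subdivision_exists[of "range (case_prod ?U)", OF _ _ d(1)])
    show "openin (top_of_set ?X) V" if "V \<in> range (case_prod ?U)" for V
      using that openin_product_star by auto
    show "topspace (top_of_set ?X) \<subseteq> \<Union> (range (case_prod ?U))"
      using X.U_cover by auto
  qed blast
  have c1: "singular_chain 1 (top_of_set (off_diagonal n)) c" using c by (simp add: singular_cycle)
  obtain l where l: "\<And>m f. \<lbrakk>l \<le> m; f \<in> Poly_Mapping.keys ((singular_subdivision 1 ^^ m) c)\<rbrakk>
      \<Longrightarrow> \<exists>W\<in>range (case_prod ?V). f \<in> standard_simplex 1 \<rightarrow> W"
  proof (rule sufficient_iterated_singular_subdivision_exists[of "range (case_prod ?V)", OF _ _ c1])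
    show "openin (top_of_set (off_diagonal n)) W" if "W \<in> range (case_prod ?V)" for W
      using that openin_off_diagonal_star by auto
    show "topspace (top_of_set (off_diagonal n)) \<subseteq> \<Union> (range (case_prod ?V))"
      using F.U_cover by auto
  qed blast
  define m where "m = max k l"
  define c' where "c' = (singular_subdivision 1 ^^ m) c"
  define d' where "d' = (singular_subdivision 2 ^^ m) d"
  have d': "chain_boundary 2 d' = c'"
    using chain_boundary_iterated_subdivision[OF d(1), of m] d(2) by (simp add: c'_def d'_def)
  have hom: "homologous_rel 1 (top_of_set (off_diagonal n)) {} c c'"
    unfolding c'_def by (rule iterated_subdivision_homologous[OF c])
  then have "singular_relcycle 1 (top_of_set (off_diagonal n)) {} c'"
    using homologous_rel_singular_relcycle c by blast
  moreover have "\<exists>u v. f ` standard_simplex 1 \<subseteq> ?V u v" if "f \<in> Poly_Mapping.keys c'" for f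
    using l[of m f] that by (auto simp: m_def c'_def Pi_iff image_subset_iff)
  ultimately have "singular_relboundary 1 (top_of_set (off_diagonal n)) {} (c' - loop_part c')"
    by (rule F.small_cycle_homologous_loop_part)
  moreover have "\<exists>u v. f ` standard_simplex 2 \<subseteq> ?U u v" if "f \<in> Poly_Mapping.keys d'" for f
    using k[of m f] that by (auto simp: m_def d'_def Pi_iff image_subset_iff)
  then have "loop_part c' = 0"
    unfolding d'[symmetric] by (intro loop_part_boundary[where n = n]) blast
  ultimately have "singular_relboundary 1 (top_of_set (off_diagonal n)) {} c'" by simp
  moreover have "singular_relboundary 1 (top_of_set (off_diagonal n)) {} (c - c')"
    using hom by (simp add: homologous_rel_def)
  ultimately have "singular_relboundary 1 (top_of_set (off_diagonal n)) {} (c' + (c - c'))"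
    by (rule singular_relboundary_add)
  then show ?thesis by simp
qed

lemma hom_induced_inclusion_iso:
  assumes inj: "\<And>c. \<lbrakk>singular_relcycle p (subtopology X T) {} c; singular_relboundary p X {} c\<rbrakk>
      \<Longrightarrow> singular_relboundary p (subtopology X T) {} c"
    and surj: "\<And>c. singular_relcycle p X {} c \<Longrightarrow>
      \<exists>c'. singular_relcycle p (subtopology X T) {} c' \<and> homologous_rel p X {} c c'"
  shows "hom_induced p (subtopology X T) {} X {} id
    \<in> iso (homology_group p (subtopology X T)) (homology_group p X)"
proof -
  let ?Y = "subtopology X T"
  let ?h = "hom_induced p ?Y {} X {} id"
  have h: "?h (homologous_rel_set p ?Y {} c) = homologous_rel_set p X {} c"
    if "singular_relcycle p ?Y {} c" for c
  proof -
    have "singular_chain p ?Y c" using that by (simp add: singular_cycle)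
    then have "chain_map p id c = c" by (simp add: chain_map_id_gen singular_chain_def)
    then show ?thesis
      using hom_induced_chain_map[of ?Y X id "{}" "{}" p c] that
      by (simp add: continuous_map_from_subtopology)
  qed
  have cyc: "singular_relcycle p X {} c" if "singular_relcycle p ?Y {} c" for c
    using that by (auto simp: singular_cycle singular_chain_subtopology)
  have "inj_on ?h (carrier (homology_group p ?Y))"
  proof (rule inj_onI)
    fix A B assume "A \<in> carrier (homology_group p ?Y)" "B \<in> carrier (homology_group p ?Y)" "?h A = ?h B"
    then obtain a b where a: "A = homologous_rel_set p ?Y {} a" "singular_relcycle p ?Y {} a"
      and b: "B = homologous_rel_set p ?Y {} b" "singular_relcycle p ?Y {} b"
      and eq: "homologous_rel_set p X {} a = homologous_rel_set p X {} b"
      using h by (auto simp: carrier_relative_homology_group)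
    have "singular_relboundary p X {} (a - b)"
      using eq homologous_rel_set_eq[of p X "{}" a b] by (simp add: homologous_rel_def)
    then have "singular_relboundary p ?Y {} (a - b)"
      using inj singular_relcycle_diff a b by blast
    then show "A = B"
      using a b homologous_rel_set_eq[of p ?Y "{}" a b] by (simp add: homologous_rel_def)
  qed
  moreover have "?h ` carrier (homology_group p ?Y) = carrier (homology_group p X)"
  proof
    show "?h ` carrier (homology_group p ?Y) \<subseteq> carrier (homology_group p X)"
      by (auto simp: hom_induced_carrier)
    show "carrier (homology_group p X) \<subseteq> ?h ` carrier (homology_group p ?Y)"
    proof
      fix A assume "A \<in> carrier (homology_group p X)"
      then obtain c where c: "A = homologous_rel_set p X {} c" "singular_relcycle p X {} c"
        by (auto simp: carrier_relative_homology_group)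
      then obtain c' where c': "singular_relcycle p ?Y {} c'" "homologous_rel p X {} c c'"
        using surj by blast
      then have "A = ?h (homologous_rel_set p ?Y {} c')"
        using c h homologous_rel_set_eq by metis
      with c' show "A \<in> ?h ` carrier (homology_group p ?Y)"
        by (auto simp: carrier_relative_homology_group)
    qed
  qed
  ultimately show ?thesis
    by (simp add: iso_def bij_betw_def hom_induced_hom hom_induced_empty_hom)
qed

section \<open>The complete graph as a space\<close>

definition edge_arc :: "nat \<Rightarrow> nat \<Rightarrow> point set" where
  "edge_arc i j = (\<lambda>t k. (1 - t) * simplex_vertex i k + t * simplex_vertex j k) ` {0..1}"

lemma connected_arc: "connected (edge_arc i j)"
  unfolding edge_arc_def
  by (intro connected_continuous_image continuous_on_coordinatewise_then_product continuous_intros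
      connected_Icc)

lemma arc_endpoints: "simplex_vertex i \<in> edge_arc i j" "simplex_vertex j \<in> edge_arc i j"
  unfolding edge_arc_def by (force intro: image_eqI[of _ _ 0] image_eqI[of _ _ 1])+

lemma arc_subset: "i < n \<Longrightarrow> j < n \<Longrightarrow> edge_arc i j \<subseteq> graph_points n"
  using hull3_vertices_subset[of i j j n]
  unfolding edge_arc_def by (intro image_subsetI) (simp add: card_insert_if subset_iff convex_combination_in_hull3)

text \<open>
  The edge may be degenerate: a vertex is the arc from itself to itself.
\<close>

lemma graph_points_in_arc:
  assumes x: "x \<in> graph_points n"
  shows "\<exists>i<n. \<exists>j<n. x \<in> edge_arc i j"
proof -
  obtain i where i: "0 < x i" using graph_points_ex_pos[OF x] by blast
  obtain j where j: "0 < x j" and supp: "\<And>k. k \<notin> {i, j} \<Longrightarrow> x k = 0"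
  proof (cases "\<exists>j. j \<noteq> i \<and> 0 < x j")
    case True
    then obtain j where j: "j \<noteq> i" "0 < x j" by blast
    have "x k = 0" if "k \<notin> {i, j}" for k
    proof (rule ccontr)
      assume "x k \<noteq> 0"
      then have "0 < x k" using graph_points_nonneg[OF x, of k] by simp
      then have "card {i, j, k} \<le> 2"
        using i j by (intro graph_points_support_card[OF x]) auto
      then show False using j that by (simp add: card_insert_if)
    qed
    with j that show thesis by blast
  next
    case False
    then have "x k = 0" if "k \<noteq> i" for k
      using that graph_points_nonneg[OF x, of k] by (metis order_le_less)
    with that[of i] i show thesis by blast
  qed
  have less: "i < n" "j < n" using graph_points_less[OF x] i j by auto
  have "sum x {i, j} = sum x {..<n}"
    by (rule sum.mono_neutral_left) (use less supp in auto)
  then have sum: "sum x {i, j} = 1" using x by (simp add: graph_points_def)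
  have "x = (\<lambda>k. (1 - (if i = j then 0 else x j)) * simplex_vertex i k +
      (if i = j then 0 else x j) * simplex_vertex j k)"
    using sum supp by (auto simp: fun_eq_iff split: if_splits)
  moreover have "(if i = j then 0 else x j) \<in> {0..1}"
    using sum i j by (auto split: if_splits)
  ultimately have "x \<in> edge_arc i j" unfolding edge_arc_def by blast
  with less show ?thesis by blast
qed

lemma connected_graph_points:
  assumes "0 < n" shows "connected (graph_points n)"
proof -
  have star: "connected (\<Union>j<n. edge_arc i j)" for i
  proof (rule connected_Union)
    show "\<Inter> (edge_arc i ` {..<n}) \<noteq> {}" using arc_endpoints(1)[of i] by blast
  qed (use connected_arc in auto)
  have base: "simplex_vertex 0 \<in> (\<Union>j<n. edge_arc i j)" for i
    using arc_endpoints(2)[of 0 i] assms by blast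
  have "connected (\<Union>i<n. \<Union>j<n. edge_arc i j)"
  proof (rule connected_Union)
    show "(\<Inter>i<n. \<Union>j<n. edge_arc i j) \<noteq> {}" using base by blast
  qed (use star in blast)
  also have "(\<Union>i<n. \<Union>j<n. edge_arc i j) = graph_points n"
  proof
    show "(\<Union>i<n. \<Union>j<n. edge_arc i j) \<subseteq> graph_points n"
      by (intro UN_least) (simp add: arc_subset)
    show "graph_points n \<subseteq> (\<Union>i<n. \<Union>j<n. edge_arc i j)"
      using graph_points_in_arc[of _ n] by blast
  qed
  finally show ?thesis .
qed

lemma arc_inter:
  assumes "x \<in> edge_arc 0 i" "x \<in> edge_arc 0 j" "i \<noteq> j" "i \<noteq> 0"
  shows "x = simplex_vertex 0"
proof -
  obtain t where t: "x = (\<lambda>k. (1 - t) * simplex_vertex 0 k + t * simplex_vertex i k)"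
    using assms(1) unfolding edge_arc_def by blast
  have "x i = 0" using assms(2-4) unfolding edge_arc_def by auto
  then have "t = 0" using t assms(4) by simp
  with t show ?thesis by (simp add: fun_eq_iff)
qed

text \<open>
  Three edges at the vertex \<open>0\<close> meet nowhere else. Under a homeomorphism to an interval their images
  are connected sets containing the image of that vertex, and two of the three other ends lie on the same side of it. The
  image of one of these two edges then contains the end of the other.
\<close>

lemma graph_points_not_interval:
  assumes "4 \<le> n"
  shows "\<not> top_of_set (graph_points n) homeomorphic_space top_of_set {0..1::real}"
proof
  assume "top_of_set (graph_points n) homeomorphic_space top_of_set {0..1::real}"
  then obtain f where "homeomorphic_map (top_of_set (graph_points n)) (top_of_set {0..1::real}) f"
    using homeomorphic_space by blast
  then have inj: "inj_on f (graph_points n)" and cont: "continuous_on (graph_points n) f"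
    by (auto dest: homeomorphic_imp_injective_map homeomorphic_imp_continuous_map)
  let ?p = "f (simplex_vertex 0)" and ?q = "\<lambda>i. f (simplex_vertex i)"
  \<comment> \<open>The ends of two different edges cannot lie on the same side; the hypothesis lets the end of the
  edge to \<open>i\<close> be the nearer one.\<close>
  have between: False
    if ij: "0 < i" "i < 4" "0 < j" "j < 4" "i \<noteq> j"
      and q: "?p < ?q i \<and> ?q i \<le> ?q j \<or> ?q j \<le> ?q i \<and> ?q i < ?p" for i j
  proof -
    have sub: "edge_arc 0 i \<subseteq> graph_points n" "edge_arc 0 j \<subseteq> graph_points n"
      using ij assms by (simp_all add: arc_subset)
    have "connected (f ` edge_arc 0 j)"
      using continuous_on_subset[OF cont sub(2)] connected_arc by (rule connected_continuous_image)
    moreover have "?p \<in> f ` edge_arc 0 j" "?q j \<in> f ` edge_arc 0 j"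
      by (intro imageI arc_endpoints)+
    ultimately have "{?p..?q j} \<subseteq> f ` edge_arc 0 j" "{?q j..?p} \<subseteq> f ` edge_arc 0 j"
      by (simp_all add: connected_contains_Icc)
    moreover have "?q i \<in> {?p..?q j} \<or> ?q i \<in> {?q j..?p}" using q by auto
    ultimately have "?q i \<in> f ` edge_arc 0 j" by blast
    then obtain x where x: "x \<in> edge_arc 0 j" "f x = ?q i" by auto
    have "x = simplex_vertex i"
      by (rule inj_onD[OF inj]) (use x sub arc_endpoints(2)[of i 0] in blast)+
    then have "simplex_vertex i = simplex_vertex 0"
      using arc_inter[of "simplex_vertex i" i j] x arc_endpoints(2)[of i 0] ij by simp
    with q show False by auto
  qed
  have "?q i \<noteq> ?p" if "0 < i" "i < 4" for i
  proof
    assume "?q i = ?p"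
    then have "simplex_vertex i = simplex_vertex 0"
      using inj that assms by (intro inj_onD[OF inj]) (auto intro!: vertex_in_graph_points)
    from fun_cong[OF this, of i] show False using that by simp
  qed
  then have "?q 1 \<noteq> ?p" "?q 2 \<noteq> ?p" "?q 3 \<noteq> ?p" by auto
  with between[of 1 2] between[of 2 1] between[of 1 3] between[of 3 1] between[of 2 3] between[of 3 2]
  show False by simp linarith
qed

lemma finite_graph_complete_graph:
  assumes "2 \<le> n" shows "finite_graph (complete_graph n)"
proof -
  have "finite (complete_graph n)"
    by (rule finite_subset[of _ "Pow {..<n}"]) (auto simp: complete_graph_def)
  moreover have "simplicial_complex_on (complete_graph n)"
    unfolding simplicial_complex_on_def
  proof (intro conjI ballI allI impI)
    fix s assume "s \<in> complete_graph n"
    then have s: "s \<subseteq> {..<n}" "s \<noteq> {}" "card s \<le> 2" by (simp_all add: complete_graph_def)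
    then show fin: "finite s" and "s \<noteq> {}" by (simp_all add: finite_subset)
    fix t assume t: "t \<subseteq> s \<and> t \<noteq> {}"
    then have "card t \<le> card s" using fin by (simp add: card_mono)
    with s t show "t \<in> complete_graph n" by (auto simp: complete_graph_def)
  qed
  moreover have "{0, 1} \<in> complete_graph n"
    using assms by (simp add: complete_graph_def)
  then have "\<exists>s\<in>complete_graph n. card s = 2" by (rule bexI[rotated]) simp
  moreover have "\<forall>s\<in>complete_graph n. card s \<le> 2"
    by (simp add: complete_graph_def)
  ultimately show ?thesis unfolding finite_graph_def by blast
qed

theorem proposition21:
  fixes n :: nat
  assumes "n \<ge> 5"
  shows "mature (complete_graph n)"
proof -
  let ?X = "graph_points n \<times> graph_points n"
  have F: "subtopology (top_of_set ?X) (off_diagonal n) = top_of_set (off_diagonal n)"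
    by (simp add: subtopology_subtopology off_diagonal_def Int_absorb1)
  have "hom_induced (int 1) (top_of_set (off_diagonal n)) {} (top_of_set ?X) {} id
      \<in> iso (homology_group (int 1) (top_of_set (off_diagonal n))) (homology_group (int 1) (top_of_set ?X))"
    using hom_induced_inclusion_iso[of 1 "top_of_set ?X" "off_diagonal n", unfolded F]
      off_diagonal_boundary[OF assms] product_cycle_homologous_off_diagonal[OF assms] by blast
  moreover have "connected_space (top_of_set (graph_points n))"
    using connected_graph_points[of n] assms by (simp add: connected_space_subtopology)
  moreover have "\<not> top_of_set (graph_points n) homeomorphic_space top_of_set {0..1::real}"
    using graph_points_not_interval assms by simp
  ultimately show ?thesis
    using finite_graph_complete_graph assms
    by (simp add: mature_def realization_complete_graph config_space2_graph_points)
qed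

end
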